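(* Consider the values $\rho^n_j$ produced by the moving-mesh Godunov-type scheme described in the context, under the CFL condition stated there. Fix $k\in[0,1]$ and $n\in\mathbb N$, and let $j\in\{-1/\delta,\dots,1/\delta\}$ with $j\ne m(n+1)$. Consider the inequality $$(E^\pm_j):\qquad \delta|\rho^{n+1}_j-k|\le\delta|\rho^n_j-k|-\tau\,(Q^{\pm,n}_{j+1}-Q^{\pm,n}_j).$$ **Case A** ($m(n+1)=m(n)$). $(E^-_j)$ holds for $j\le m(n+1)-2$, $(E^+_j)$ holds for $j\ge m(n+1)+2$, and $$\Delta_L^{n+1}|\rho_L^{n+1}-k|\le\Delta_L^n|\rho_L^n-k|-\tau(Q_0^n-Q^{-,n}_{m(n)-1})+\tau R_L(k,\alpha_n),$$ $$\Delta_R^{n+1}|\rho_R^{n+1}-k|\le\Delta_R^n|\rho_R^n-k|-\tau(Q^{+,n}_{m(n)+2}-Q_0^n)+\tau R_R(k,\alpha_n).$$ **Case B** ($m(n+1)=m(n)+1$). $(E^-_j)$ holds for $j\le m(n+1)-3$, $(E^+_j)$ holds for $j\ge m(n+1)+2$, and $$(\Delta_L^{n+1}+\delta)|\bar\rho-k|\le\Delta_L^n|\rho_L^n-k|-\tau(Q_0^n-Q^{-,n}_{m(n)-1})+\tau R_L(k,\alpha_n),$$ $$\Delta_R^{n+1}|\rho_R^{n+1}-k|\le\Delta_R^n|\rho_R^n-k|+\delta|\rho^n_{m(n)+2}-k|-\tau(Q^{+,n}_{m(n)+3}-Q_0^n)+\tau R_R(k,\alpha_n),$$ where $\bar\rho=\rho^{n+1}_{m(n+1)-2}=\rho_L^{n+1}$.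 **Case C** ($m(n+1)=m(n)-1$). $(E^-_j)$ holds for $j\le m(n+1)-2$, $(E^+_j)$ holds for $j\ge m(n+1)+3$, and $$(\Delta_R^{n+1}+\delta)|\bar\rho-k|\le\Delta_R^n|\rho_R^n-k|-\tau(Q^{+,n}_{m(n)+2}-Q_0^n)+\tau R_R(k,\alpha_n),$$ $$\Delta_L^{n+1}|\rho_L^{n+1}-k|\le\Delta_L^n|\rho_L^n-k|+\delta|\rho^n_{m(n)-2}-k|-\tau(Q_0^n-Q^{-,n}_{m(n)-2})+\tau R_L(k,\alpha_n),$$ where $\bar\rho=\rho_R^{n+1}=\rho^{n+1}_{m(n+1)+2}$.
   Context: **Data.** $f:[0,1]\to[0,\infty)$ is concave, $f(0)=f(1)=0$, $\max f>0$, $\lim_{\rho\to0+}f(\rho)/\rho\in\mathbb R$; $\|f'\|_\infty$ denotes the Lipschitz constant of $f$ (finite). $v(\rho):=f(\rho)/\rho$ for $\rho\in(0,1]$, $v(0):=\lim_{\rho\to0+}f(\rho)/\rho$. $\xi:[0,\infty)\to(-1,1)$ is Lipschitz continuous with $[\inf\xi,\sup\xi]\subset(-1,1)$ and $\|\xi'\|_\infty$ is its Lipschitz constant. Initial datum $\rho_0\in L^\infty((-1,1);[0,1])$ (extended by $0$ outside $(-1,1)$). **Mesh.** $\delta=2^{-N}$ is the space step, with $N\in\mathbb N$ so large that $\|\xi\|_\infty<1-\delta'/2$ for $\delta'=2^{-N'}$, all $N'\ge N$. $x_{j+1/2}=(j+\tfrac12)\delta$, $C_j=[x_{j-1/2},x_{j+1/2})$,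 $j\in\mathbb Z$. $\tau>0$ is the time step, $t^n=n\tau$, and the CFL condition $\tau\max\{\|f'\|_\infty,\|\xi'\|_\infty\}\le\delta/2$ holds. $\xi^n=\xi(t^n)$, $\alpha_n=(\xi^{n+1}-\xi^n)/\tau$. $m(n)$ is the index with $\xi^n\in[x_{m(n)-1/2},x_{m(n)+1/2})$; one has $|m(n)|\le 1/\delta-1$ and $m(n+1)\in\{m(n),m(n)\pm1\}$. At time $t^n$ the cells $\mathsf C^n_j$, $|j|\le1/\delta$, $j\ne m(n)$, are: $\mathsf C^n_j=C_j$ if $|j-m(n)|\ge2$; $\mathsf C^n_{m(n)-1}=D^n_L=[x_{m(n)-3/2},\xi^n)$; $\mathsf C^n_{m(n)+1}=D^n_R=[\xi^n,x_{m(n)+3/2})$. $\Delta^n_L=|D^n_L|$, $\Delta^n_R=|D^n_R|$ (so $\delta\le\Delta_L^n,\Delta_R^n\le2\delta$, $\Delta_L^n+\Delta_R^n=3\delta$). **Numerical fluxes.** $h^\pm(a,b)=\min_{[a,b]}(\pm f)$ if $a\le b$, $h^\pm(a,b)=\max_{[b,a]}(\pm f)$ if $a\ge b$; $h_0(a,b,\alpha)=f(b)-\alpha b$ if $\alpha\ge v(b)$, $=-f(a)-\alpha a$ if $\alpha\le-v(a)$, $=0$ otherwise. **Scheme.** Initialization: $\rho^0_j=|\mathsf C^0_j|^{-1}\int_{\mathsf C^0_j}\rho_0\,dx$ for $|j|\le1/\delta$, $j\neq m(0)$. For all $n$, $\rho^n_{\pm(1+1/\delta)}=0$. Write $\rho^n_L=\rho^n_{m(n)-1}$,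 $\rho^n_R=\rho^n_{m(n)+1}$. Define the standard updates $(S^\pm)$: $\rho^{n+1}_j=\rho^n_j-\frac{\tau}{\delta}[h^\pm(\rho^n_j,\rho^n_{j+1})-h^\pm(\rho^n_{j-1},\rho^n_j)]$. Case A, $m(n+1)=m(n)$: $(S^-)$ for $-1/\delta\le j\le m(n+1)-2$, $(S^+)$ for $m(n+1)+2\le j\le1/\delta$, and $\Delta_L^{n+1}\rho_L^{n+1}=\Delta_L^n\rho_L^n-\tau[h_0(\rho_L^n,\rho_R^n,\alpha_n)-h^-(\rho^n_{m(n)-2},\rho_L^n)]$, $\Delta_R^{n+1}\rho_R^{n+1}=\Delta_R^n\rho_R^n-\tau[h^+(\rho_R^n,\rho^n_{m(n)+2})-h_0(\rho_L^n,\rho_R^n,\alpha_n)]$. Case B, $m(n+1)=m(n)+1$: $(S^-)$ for $-1/\delta\le j\le m(n+1)-3$, $(S^+)$ for $m(n+1)+2\le j\le1/\delta$; $\rho^{n+1}_{m(n+1)-2}=\rho^{n+1}_L=\bar\rho$ with $(\delta+\Delta_L^{n+1})\bar\rho=\Delta_L^n\rho_L^n-\tau[h_0(\rho_L^n,\rho_R^n,\alpha_n)-h^-(\rho^n_{m(n)-2},\rho_L^n)]$, and $\Delta_R^{n+1}\rho_R^{n+1}=\Delta_R^n\rho_R^n+\delta\rho^n_{m(n)+2}-\tau[h^+(\rho^n_{m(n)+2},\rho^n_{m(n)+3})-h_0(\rho_L^n,\rho_R^n,\alpha_n)]$. Case C, $m(n+1)=m(n)-1$: $(S^-)$ for $-1/\delta\le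 j\le m(n+1)-2$, $(S^+)$ for $m(n+1)+3\le j\le1/\delta$; $\Delta_L^{n+1}\rho_L^{n+1}=\Delta_L^n\rho_L^n+\delta\rho^n_{m(n)-2}-\tau[h_0(\rho_L^n,\rho_R^n,\alpha_n)-h^-(\rho^n_{m(n)-3},\rho^n_{m(n)-2})]$, and $\rho^{n+1}_R=\rho^{n+1}_{m(n+1)+2}=\bar\rho$ with $(\delta+\Delta_R^{n+1})\bar\rho=\Delta_R^n\rho_R^n-\tau[h^+(\rho_R^n,\rho^n_{m(n)+2})-h_0(\rho_L^n,\rho_R^n,\alpha_n)]$. **Discrete entropy fluxes and remainders.** With $a\vee b=\max\{a,b\}$, $a\wedge b=\min\{a,b\}$: $Q^{\pm,n}_j=h^\pm(\rho^n_{j-1}\vee k,\rho^n_j\vee k)-h^\pm(\rho^n_{j-1}\wedge k,\rho^n_j\wedge k)$, $Q^n_0=h_0(\rho^n_L\vee k,\rho^n_R\vee k,\alpha_n)-h_0(\rho^n_L\wedge k,\rho^n_R\wedge k,\alpha_n)$. $R_L(b,\alpha)=0$ if $\alpha\le-v(b)$, $R_L(b,\alpha)=f(b)+\alpha b$ if $-v(b)<\alpha<v(b)$, $R_L(b,\alpha)=2f(b)$ if $\alpha\ge v(b)$; $R_R(b,\alpha)=2f(b)-R_L(b,\alpha)$. *)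

theory Defs
  imports "HOL-Analysis.Analysis"
begin

text \<open>Best (least) Lipschitz constant, written as the sup norm of the derivative
  in the usual notation; only meaningful for functions that are Lipschitz on \<open>S\<close>.\<close>

definition lip_const :: "real set \<Rightarrow> (real \<Rightarrow> real) \<Rightarrow> real" where
  "lip_const S g = Inf {L. L-lipschitz_on S g}"

definition velocity :: "(real \<Rightarrow> real) \<Rightarrow> real \<Rightarrow> real" where
  "velocity f r = (if r = 0 then Lim (at_right 0) (\<lambda>s. f s / s) else f r / r)"


section \<open>Moving mesh\<close>

text \<open>\<open>node \<delta> j\<close> is the point $x_{j+1/2}$, so $x_{j-1/2}$ is \<open>node \<delta> (j - 1)\<close>.\<close>

definition node :: "real \<Rightarrow> int \<Rightarrow> real" where
  "node \<delta> j = (of_int j + 1 / 2) * \<delta>"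

definition fixed_cell :: "real \<Rightarrow> int \<Rightarrow> real set" where
  "fixed_cell \<delta> j = {node \<delta> (j - 1)..<node \<delta> j}"

definition tp_index :: "(real \<Rightarrow> real) \<Rightarrow> real \<Rightarrow> real \<Rightarrow> nat \<Rightarrow> int" where
  "tp_index \<xi> \<delta> \<tau> n = (THE j. \<xi> (real n * \<tau>) \<in> fixed_cell \<delta> j)"

definition tp_slope :: "(real \<Rightarrow> real) \<Rightarrow> real \<Rightarrow> nat \<Rightarrow> real" where
  "tp_slope \<xi> \<tau> n = (\<xi> (real (n + 1) * \<tau>) - \<xi> (real n * \<tau>)) / \<tau>"

definition cell_L :: "(real \<Rightarrow> real) \<Rightarrow> real \<Rightarrow> real \<Rightarrow> nat \<Rightarrow> real set" where
  "cell_L \<xi> \<delta> \<tau> n = {node \<delta> (tp_index \<xi> \<delta> \<tau> n - 2)..<\<xi> (real n * \<tau>)}"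

definition cell_R :: "(real \<Rightarrow> real) \<Rightarrow> real \<Rightarrow> real \<Rightarrow> nat \<Rightarrow> real set" where
  "cell_R \<xi> \<delta> \<tau> n = {\<xi> (real n * \<tau>)..<node \<delta> (tp_index \<xi> \<delta> \<tau> n + 1)}"

definition size_L :: "(real \<Rightarrow> real) \<Rightarrow> real \<Rightarrow> real \<Rightarrow> nat \<Rightarrow> real" where
  "size_L \<xi> \<delta> \<tau> n = measure lebesgue (cell_L \<xi> \<delta> \<tau> n)"

definition size_R :: "(real \<Rightarrow> real) \<Rightarrow> real \<Rightarrow> real \<Rightarrow> nat \<Rightarrow> real" where
  "size_R \<xi> \<delta> \<tau> n = measure lebesgue (cell_R \<xi> \<delta> \<tau> n)"

text \<open>There is no cell with index \<open>tp_index \<xi> \<delta> \<tau> n\<close>; the value of \<open>cell\<close> there is never used.\<close>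

definition cell :: "(real \<Rightarrow> real) \<Rightarrow> real \<Rightarrow> real \<Rightarrow> nat \<Rightarrow> int \<Rightarrow> real set" where
  "cell \<xi> \<delta> \<tau> n j =
     (if j = tp_index \<xi> \<delta> \<tau> n - 1 then cell_L \<xi> \<delta> \<tau> n
      else if j = tp_index \<xi> \<delta> \<tau> n + 1 then cell_R \<xi> \<delta> \<tau> n
      else fixed_cell \<delta> j)"


section \<open>Numerical fluxes\<close>

text \<open>All fluxes below are continuous on $[0,1]$, so the infimum and supremum are the
  minimum and maximum.\<close>

definition godunov :: "(real \<Rightarrow> real) \<Rightarrow> real \<Rightarrow> real \<Rightarrow> real" where
  "godunov g a b = (if a \<le> b then (INF x\<in>{a..b}. g x) else (SUP x\<in>{b..a}. g x))"

definition h_plus :: "(real \<Rightarrow> real) \<Rightarrow> real \<Rightarrow> real \<Rightarrow> real" where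
  "h_plus f = godunov f"

definition h_minus :: "(real \<Rightarrow> real) \<Rightarrow> real \<Rightarrow> real \<Rightarrow> real" where
  "h_minus f = godunov (\<lambda>x. - f x)"

text \<open>For $a,b\in[0,1]$ the first two branches overlap only if $a=b=1$ and $\alpha=0$,
  where both give \<open>0\<close>. The same holds for \<open>rem_L\<close>.\<close>

definition h_zero :: "(real \<Rightarrow> real) \<Rightarrow> real \<Rightarrow> real \<Rightarrow> real \<Rightarrow> real" where
  "h_zero f a b \<alpha> =
     (if \<alpha> \<ge> velocity f b then f b - \<alpha> * b
      else if \<alpha> \<le> - velocity f a then - f a - \<alpha> * a
      else 0)"

definition rem_L :: "(real \<Rightarrow> real) \<Rightarrow> real \<Rightarrow> real \<Rightarrow> real" where
  "rem_L f b \<alpha> =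
     (if \<alpha> \<le> - velocity f b then 0
      else if \<alpha> < velocity f b then f b + \<alpha> * b
      else 2 * f b)"

definition rem_R :: "(real \<Rightarrow> real) \<Rightarrow> real \<Rightarrow> real \<Rightarrow> real" where
  "rem_R f b \<alpha> = 2 * f b - rem_L f b \<alpha>"


section \<open>The scheme\<close>

text \<open>In the following \<open>u\<close> and \<open>w\<close> are the values at times $t^n$ and $t^{n+1}$.\<close>

definition std_update ::
  "(real \<Rightarrow> real \<Rightarrow> real) \<Rightarrow> real \<Rightarrow> real \<Rightarrow> (int \<Rightarrow> real) \<Rightarrow> (int \<Rightarrow> real) \<Rightarrow> int \<Rightarrow> bool" where
  "std_update h \<delta> \<tau> u w j \<longleftrightarrow>
     w j = u j - \<tau> / \<delta> * (h (u j) (u (j + 1)) - h (u (j - 1)) (u j))"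

definition scheme_step ::
  "(real \<Rightarrow> real) \<Rightarrow> (real \<Rightarrow> real) \<Rightarrow> nat \<Rightarrow> real \<Rightarrow> nat \<Rightarrow> (int \<Rightarrow> real) \<Rightarrow> (int \<Rightarrow> real) \<Rightarrow> bool" where
  "scheme_step f \<xi> N \<tau> n u w \<longleftrightarrow>
    (let \<delta> = 1 / 2 ^ N;
         m = tp_index \<xi> \<delta> \<tau> n; m' = tp_index \<xi> \<delta> \<tau> (n + 1);
         \<Delta>L = size_L \<xi> \<delta> \<tau> n; \<Delta>L' = size_L \<xi> \<delta> \<tau> (n + 1);
         \<Delta>R = size_R \<xi> \<delta> \<tau> n; \<Delta>R' = size_R \<xi> \<delta> \<tau> (n + 1);
         hp = h_plus f; hm = h_minus f;
         h0 = h_zero f (u (m - 1)) (u (m + 1)) (tp_slope \<xi> \<tau> n)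
     in
      (m' = m \<longrightarrow>
         (\<forall>j\<in>{- (2 ^ N)..m' - 2}. std_update hm \<delta> \<tau> u w j) \<and>
         (\<forall>j\<in>{m' + 2..2 ^ N}. std_update hp \<delta> \<tau> u w j) \<and>
         \<Delta>L' * w (m' - 1) = \<Delta>L * u (m - 1) - \<tau> * (h0 - hm (u (m - 2)) (u (m - 1))) \<and>
         \<Delta>R' * w (m' + 1) = \<Delta>R * u (m + 1) - \<tau> * (hp (u (m + 1)) (u (m + 2)) - h0)) \<and>
      (m' = m + 1 \<longrightarrow>
         (\<forall>j\<in>{- (2 ^ N)..m' - 3}. std_update hm \<delta> \<tau> u w j) \<and>
         (\<forall>j\<in>{m' + 2..2 ^ N}. std_update hp \<delta> \<tau> u w j) \<and>
         w (m' - 2) = w (m' - 1) \<and>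
         (\<delta> + \<Delta>L') * w (m' - 1) = \<Delta>L * u (m - 1) - \<tau> * (h0 - hm (u (m - 2)) (u (m - 1))) \<and>
         \<Delta>R' * w (m' + 1) = \<Delta>R * u (m + 1) + \<delta> * u (m + 2)
                             - \<tau> * (hp (u (m + 2)) (u (m + 3)) - h0)) \<and>
      (m' = m - 1 \<longrightarrow>
         (\<forall>j\<in>{- (2 ^ N)..m' - 2}. std_update hm \<delta> \<tau> u w j) \<and>
         (\<forall>j\<in>{m' + 3..2 ^ N}. std_update hp \<delta> \<tau> u w j) \<and>
         \<Delta>L' * w (m' - 1) = \<Delta>L * u (m - 1) + \<delta> * u (m - 2)
                             - \<tau> * (h0 - hm (u (m - 3)) (u (m - 2))) \<and>
         w (m' + 2) = w (m' + 1) \<and>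
         (\<delta> + \<Delta>R') * w (m' + 1) = \<Delta>R * u (m + 1) - \<tau> * (hp (u (m + 1)) (u (m + 2)) - h0)))"

text \<open>The values $\rho^n_j$ are \<open>\<rho> n j\<close>. Under the CFL condition the equations below determine
  \<open>\<rho> n j\<close> exactly for $|j|\le 1+1/\delta$ and $j$ different from the index of the cell containing
  $\xi(t^n)$; the remaining values are irrelevant. Here $1/\delta$ is \<open>2 ^ N\<close>.\<close>

definition scheme_solution ::
  "(real \<Rightarrow> real) \<Rightarrow> (real \<Rightarrow> real) \<Rightarrow> nat \<Rightarrow> real \<Rightarrow> (real \<Rightarrow> real) \<Rightarrow> (nat \<Rightarrow> int \<Rightarrow> real) \<Rightarrow> bool" where
  "scheme_solution f \<xi> N \<tau> \<rho>\<^sub>0 \<rho> \<longleftrightarrow>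
     (\<forall>j\<in>{- (2 ^ N)..2 ^ N} - {tp_index \<xi> (1 / 2 ^ N) \<tau> 0}.
        \<rho> 0 j = (LINT x:cell \<xi> (1 / 2 ^ N) \<tau> 0 j|lebesgue. indicator {-1<..<1} x * \<rho>\<^sub>0 x)
                  / measure lebesgue (cell \<xi> (1 / 2 ^ N) \<tau> 0 j)) \<and>
     (\<forall>n. \<rho> n (1 + 2 ^ N) = 0 \<and> \<rho> n (- (1 + 2 ^ N)) = 0) \<and>
     (\<forall>n. scheme_step f \<xi> N \<tau> n (\<rho> n) (\<rho> (n + 1)))"


section \<open>Discrete entropy fluxes\<close>

definition entropy_flux ::
  "(real \<Rightarrow> real \<Rightarrow> real) \<Rightarrow> real \<Rightarrow> (int \<Rightarrow> real) \<Rightarrow> int \<Rightarrow> real" where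
  "entropy_flux h k u j =
     h (max (u (j - 1)) k) (max (u j) k) - h (min (u (j - 1)) k) (min (u j) k)"

definition entropy_flux_zero :: "(real \<Rightarrow> real) \<Rightarrow> real \<Rightarrow> real \<Rightarrow> real \<Rightarrow> real \<Rightarrow> real" where
  "entropy_flux_zero f k a b \<alpha> =
     h_zero f (max a k) (max b k) \<alpha> - h_zero f (min a k) (min b k) \<alpha>"

definition entropy_ineq ::
  "(real \<Rightarrow> real \<Rightarrow> real) \<Rightarrow> real \<Rightarrow> real \<Rightarrow> real \<Rightarrow> (int \<Rightarrow> real) \<Rightarrow> (int \<Rightarrow> real) \<Rightarrow> int \<Rightarrow> bool" where
  "entropy_ineq h \<delta> \<tau> k u w j \<longleftrightarrow>
     \<delta> * \<bar>w j - k\<bar> \<le> \<delta> * \<bar>u j - k\<bar> - \<tau> * (entropy_flux h k u (j + 1) - entropy_flux h k u j)"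

end

theory Submission
  imports Defs
begin

text \<open>
  Every update of the scheme is a nondecreasing function of the data at time $t^n$, as in the
  argument of Crandall and Majda: comparing the update of the data with the updates of
  $\rho\vee k$, $\rho\wedge k$ and of the constant state $k$ gives the entropy inequality, and
  comparing with the constants $0$ and $1$ keeps the values in $[0,1]$. Next to the interface a
  constant state is not preserved; its defect is exactly the remainder $R_L$ or $R_R$. Since
  $h^-(a,b)=-h^+(b,a)$ and $h_0(a,b,\alpha)=-h_0(b,a,-\alpha)$, the cell to the right of the
  interface is the mirror image of the cell to its left.
\<close>

text \<open>Monotonicity is available only for data in [0,1]: there concavity and
  \<open>f 0 = 0\<close> make the velocity nonincreasing, and nonnegativity of \<open>f\<close>
  separates the thresholds of \<open>h_zero\<close>. The range bounds therefore have to be carried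
  along by induction over the time steps before any entropy inequality can be derived. The defect of
  a constant state comes from the mesh motion: the cell has length \<Delta> before the step and D =
  \<Delta> + \<tau>\<alpha> after it, and the unbalanced term \<alpha>k joins f(k) and
  h_0(k,k,\<alpha>) to form R_L. This defect has a sign. A constant can only lose mass, so 1 remains
  an upper bound and the absolute value costs no more than \<tau>R_L. The six interface inequalities
  reduce, up to reflection, to two update shapes. In one, the adjacent cell is updated alone, and D
  may be the total length of two new cells sharing one value. In the other, it absorbs a
  neighbouring fixed cell.\<close>

text \<open>The infimum is attained: each pair of distinct points imposes only a lower bound on the
  constant, and a lower bound valid for all admissible constants passes to their infimum.\<close>

lemma lip_const_lipschitz:
  assumes "\<exists>L. L-lipschitz_on S g"
  shows "(lip_const S g)-lipschitz_on S g"
proof (rule lipschitz_onI)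
  let ?A = "{L. L-lipschitz_on S g}"
  have ne: "?A \<noteq> {}" using assms by auto
  fix x y assume xy: "x \<in> S" "y \<in> S"
  show "dist (g x) (g y) \<le> lip_const S g * dist x y"
  proof (cases "x = y")
    case False
    then have "dist x y > 0" by simp
    moreover from this have "dist (g x) (g y) / dist x y \<le> Inf ?A"
      using xy by (intro cInf_greatest[OF ne]) (auto simp: divide_le_eq dest: lipschitz_onD)
    ultimately show ?thesis by (simp add: lip_const_def divide_le_eq)
  qed simp
next
  show "0 \<le> lip_const S g"
    unfolding lip_const_def using assms
    by (intro cInf_greatest) (auto dest: lipschitz_on_nonneg)
qed

section \<open>Godunov fluxes\<close>

lemma godunov_le_attained:
  assumes "continuous_on {a..b} g" "a \<le> b"
  obtains s where "s \<in> {a..b}" "godunov g a b = g s" "\<And>x. x \<in> {a..b} \<Longrightarrow> g s \<le> g x"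
proof -
  obtain s where s: "s \<in> {a..b}" "\<And>x. x \<in> {a..b} \<Longrightarrow> g s \<le> g x"
    using continuous_attains_inf[of "{a..b}" g] assms by auto
  then have "(INF x\<in>{a..b}. g x) = g s"
    by (intro cInf_eq_minimum) auto
  then show thesis using that s assms by (simp add: godunov_def)
qed

lemma godunov_same: "godunov g a a = g a"
  by (simp add: godunov_def)

text \<open>On the reals \<open>Inf\<close> is by definition the negated \<open>Sup\<close> of the
  negated set, so exchanging minimum and maximum is a purely algebraic identity.\<close>

lemma godunov_reflect: "godunov (\<lambda>x. - g x) a b = - godunov g b a"
  for g :: "real \<Rightarrow> real"
proof (cases a b rule: linorder_cases)
  case less
  then show ?thesis by (simp add: godunov_def Inf_real_def image_image)
next
  case greater
  then show ?thesis by (simp add: godunov_def Inf_real_def image_image)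
qed (simp add: godunov_same)

lemma godunov_ge_attained:
  assumes "continuous_on {b..a} g" "b \<le> a"
  obtains s where "s \<in> {b..a}" "godunov g a b = g s" "\<And>x. x \<in> {b..a} \<Longrightarrow> g x \<le> g s"
proof -
  obtain s where "s \<in> {b..a}" "godunov (\<lambda>x. - g x) b a = - g s"
      "\<And>x. x \<in> {b..a} \<Longrightarrow> - g s \<le> - g x"
    using godunov_le_attained[of b a "\<lambda>x. - g x"] assms by (auto intro: continuous_on_minus)
  then show thesis using that by (simp add: godunov_reflect)
qed

text \<open>The last bound expresses that \<open>godunov g _ c - g\<close> has one-sided slope at most \<open>L\<close>: the
  flux can only grow together with \<open>g\<close>. This is what keeps the CFL constant at $1/2$ next to
  the moving interface.\<close>

lemma godunov_left:
  assumes lip: "L-lipschitz_on {l..u} g"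
    and "a \<in> {l..u}" "a' \<in> {l..u}" "c \<in> {l..u}" "a \<le> a'"
  shows godunov_left_mono: "godunov g a c \<le> godunov g a' c"
    and godunov_left_lip: "godunov g a' c \<le> godunov g a c + L * (a' - a)"
    and godunov_left_slope: "godunov g a' c \<le> godunov g a c + (g a' - g a) + L * (a' - a)"
proof -
  let ?G = "\<lambda>a. godunov g a c"
  \<comment> \<open>The three estimates are bundled because each is additive along \<open>a\<close>,
    \<open>c\<close>, \<open>a'\<close>; an interval that contains \<open>c\<close> can then be
    split there.\<close>
  define P where "P = (\<lambda>a a'. ?G a \<le> ?G a' \<and> ?G a' \<le> ?G a + L * (a' - a)
    \<and> ?G a' \<le> ?G a + (g a' - g a) + L * (a' - a))"
  have L0: "L \<ge> 0" using lip by (rule lipschitz_on_nonneg)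
  have cont: "continuous_on {p..q} g" if "l \<le> p" "q \<le> u" for p q
    using continuous_on_subset[OF lipschitz_on_continuous_on[OF lip]] that by auto
  have lipD: "\<bar>g x - g y\<bar> \<le> L * (q - p)"
    if "x \<in> {p..q}" "y \<in> {p..q}" "l \<le> p" "q \<le> u" for x y p q
  proof -
    have "\<bar>g x - g y\<bar> \<le> L * \<bar>x - y\<bar>"
      using lipschitz_onD[OF lip, of x y] that by (auto simp: dist_real_def)
    also have "\<dots> \<le> L * (q - p)" using that L0 by (intro mult_left_mono) auto
    finally show ?thesis .
  qed
  have below: "P a a'" if ord: "a \<le> a'" "a' \<le> c" "l \<le> a" "c \<le> u" for a a'
  proof -
    obtain s where s: "s \<in> {a..c}" "?G a = g s" "\<And>x. x \<in> {a..c} \<Longrightarrow> g s \<le> g x"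
      by (rule godunov_le_attained[OF cont[of a c]]) (use ord in auto)
    obtain s' where s': "s' \<in> {a'..c}" "?G a' = g s'" "\<And>x. x \<in> {a'..c} \<Longrightarrow> g s' \<le> g x"
      by (rule godunov_le_attained[OF cont[of a' c]]) (use ord in auto)
    have 1: "g s \<le> g s'" using s(3)[of s'] s'(1) that by auto
    have e: "\<bar>g a - g a'\<bar> \<le> L * (a' - a)" using lipD[of a a a' a'] that by auto
    show ?thesis
    proof (cases "s \<ge> a'")
      case True
      then have "g s = g s'" using s'(3)[of s] s(1) 1 by auto
      then show ?thesis using s(2) s'(2) e L0 that by (auto simp: P_def)
    next
      \<comment> \<open>The old minimizer \<open>s\<close> lies in the lost piece between
        \<open>a\<close> and \<open>a'\<close>. The new minimum is at most \<open>g a'\<close>, so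
        the flux grows by at most \<open>g a' - g s\<close>; comparing \<open>g s\<close> with
        \<open>g a'\<close> or with \<open>g a\<close> gives the two upper bounds.\<close>
      case False
      moreover have "g s' \<le> g a'" using s'(3)[of a'] that by auto
      moreover have "\<bar>g a' - g s\<bar> \<le> L * (a' - a)" "\<bar>g a - g s\<bar> \<le> L * (a' - a)"
        using lipD[of a' a a' s] lipD[of a a a' s] False s(1) that by auto
      ultimately show ?thesis using s(2) s'(2) 1 unfolding P_def by linarith
    qed
  qed
  have above: "P a a'" if ord: "a \<le> a'" "c \<le> a" "l \<le> c" "a' \<le> u" for a a'
  proof -
    obtain s where s: "s \<in> {c..a}" "?G a = g s" "\<And>x. x \<in> {c..a} \<Longrightarrow> g x \<le> g s"
      by (rule godunov_ge_attained[OF cont[of c a]]) (use ord in auto)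
    obtain s' where s': "s' \<in> {c..a'}" "?G a' = g s'" "\<And>x. x \<in> {c..a'} \<Longrightarrow> g x \<le> g s'"
      by (rule godunov_ge_attained[OF cont[of c a']]) (use ord in auto)
    have 1: "g s \<le> g s'" using s'(3)[of s] s(1) that by auto
    have e: "\<bar>g a - g a'\<bar> \<le> L * (a' - a)" using lipD[of a a a' a'] that by auto
    show ?thesis
    proof (cases "s' \<le> a")
      case True
      then have "g s = g s'" using s(3)[of s'] s'(1) 1 by auto
      then show ?thesis using s(2) s'(2) e L0 that by (auto simp: P_def)
    next
      case False
      moreover have "g a \<le> g s" using s(3)[of a] that by auto
      moreover have "\<bar>g a' - g s'\<bar> \<le> L * (a' - a)" "\<bar>g a - g s'\<bar> \<le> L * (a' - a)"
        using lipD[of a' a a' s'] lipD[of a a a' s'] False s'(1) that by auto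
      ultimately show ?thesis using s(2) s'(2) 1 unfolding P_def by linarith
    qed
  qed
  have trans: "P a a'" if "P a c" "P c a'" for a a'
    using that by (auto simp: P_def algebra_simps)
  consider "a' \<le> c" | "c \<le> a" | "a \<le> c" "c \<le> a'" by linarith
  then have "P a a'"
  proof cases
    case 3
    show ?thesis by (rule trans[OF below above]) (use 3 assms in auto)
  qed (use assms below above in auto)
  then show "?G a \<le> ?G a'" "?G a' \<le> ?G a + L * (a' - a)"
      "?G a' \<le> ?G a + (g a' - g a) + L * (a' - a)"
    by (auto simp: P_def)
qed

text \<open>Reflection exchanges the two arguments, so these are the bounds of
  \<open>godunov_left\<close> for the negated function.\<close>

lemma godunov_right:
  assumes lip: "L-lipschitz_on {l..u} g"
    and "a \<in> {l..u}" "a' \<in> {l..u}" "c \<in> {l..u}" "a \<le> a'"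
  shows godunov_right_antimono: "godunov g c a' \<le> godunov g c a"
    and godunov_right_lip: "godunov g c a \<le> godunov g c a' + L * (a' - a)"
proof -
  have "L-lipschitz_on {l..u} (\<lambda>x. - g x)" using lip by simp
  from godunov_left_mono[OF this assms(2-)] godunov_left_lip[OF this assms(2-)]
  show "godunov g c a' \<le> godunov g c a" "godunov g c a \<le> godunov g c a' + L * (a' - a)"
    by (auto simp: godunov_reflect)
qed

lemma h_minus_eq: "h_minus f a b = - godunov f b a"
  by (simp add: h_minus_def godunov_reflect)

section \<open>The flux at the interface\<close>

locale concave_flux =
  fixes f :: "real \<Rightarrow> real" and L :: real
  assumes nonneg: "\<And>r. r \<in> {0..1} \<Longrightarrow> 0 \<le> f r"
    and concave: "concave_on {0..1} f"
    and zero: "f 0 = 0"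
    and slope_0: "\<exists>l. ((\<lambda>r. f r / r) \<longlongrightarrow> l) (at_right 0)"
    and lip: "L-lipschitz_on {0..1} f"
begin

lemma velocity_nonneg: "r \<in> {0..1} \<Longrightarrow> 0 \<le> velocity f r"
proof (cases "r = 0")
  case True
  obtain l where l: "((\<lambda>r. f r / r) \<longlongrightarrow> l) (at_right 0)" using slope_0 by auto
  have "eventually (\<lambda>r::real. r \<in> {0<..<1}) (at_right 0)"
    by (rule eventually_at_right_real) simp
  then have "eventually (\<lambda>r. 0 \<le> f r / r) (at_right 0)"
    by (rule eventually_mono) (auto intro!: divide_nonneg_nonneg nonneg)
  then have "0 \<le> l" by (rule tendsto_lowerbound[OF l]) simp
  moreover have "Lim (at_right 0) (\<lambda>r. f r / r) = l" by (rule tendsto_Lim[OF _ l]) simp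
  ultimately show ?thesis using True by (simp add: velocity_def)
qed (auto simp: velocity_def nonneg)

text \<open>\<open>sweep \<beta> r\<close> is the flux of a state \<open>r\<close> relative to an interface that runs into it
  at speed \<open>\<beta>\<close>. Writing \<open>h_zero\<close> as a difference of two such terms makes its monotonicity
  and its reflection symmetry visible.\<close>

definition sweep :: "real \<Rightarrow> real \<Rightarrow> real" where
  "sweep \<beta> r = min 0 (f r - \<beta> * r)"

text \<open>Concavity and \<open>f 0 = 0\<close> make f(r)/r nonincreasing. Once it falls below
  \<beta> it stays there, and f(r) - \<beta>r is then a growing r times a negative nonincreasing
  factor. Before that threshold \<open>sweep\<close> has its largest value 0.\<close>

lemma sweep_antimono:
  assumes "0 \<le> a" "a \<le> a'" "a' \<le> 1"
  shows "sweep \<beta> a' \<le> sweep \<beta> a"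
proof (cases "f a < \<beta> * a")
  case True
  then have a: "a > 0" using assms zero by (cases "a = 0") auto
  have "a / a' * f a' + (1 - a / a') * f 0 \<le> f (a / a' * a' + (1 - a / a') * 0)"
    using concave_onD[OF concave, of "1 - a / a'" a' 0] assms a
    by (simp add: algebra_simps)
  then have "a * f a' \<le> f a * a'" using a assms zero by (simp add: field_simps)
  then have "a * (f a' - \<beta> * a') \<le> a' * (f a - \<beta> * a)" by (simp add: algebra_simps)
  also have "\<dots> \<le> a * (f a - \<beta> * a)"
    using assms True by (intro mult_right_mono_neg) auto
  finally have "f a' - \<beta> * a' \<le> f a - \<beta> * a" using a by simp
  then show ?thesis by (auto simp: sweep_def)
qed (auto simp: sweep_def)

lemma velocity_le_iff: "0 < r \<Longrightarrow> velocity f r \<le> \<alpha> \<longleftrightarrow> f r - \<alpha> * r \<le> 0"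
  by (simp add: velocity_def field_simps)

text \<open>The velocity thresholds mark where the minimum in \<open>sweep\<close> is active. Only
  the state the interface runs into matters: \<open>b\<close> for positive \<alpha>,
  \<open>a\<close> for negative \<alpha>; the other term is \<open>sweep 0\<close>, which vanishes
  because \<open>f\<close> is nonnegative.\<close>

lemma h_zero_eq:
  assumes "a \<in> {0..1}" "b \<in> {0..1}"
  shows "h_zero f a b \<alpha> = sweep (max \<alpha> 0) b - sweep (max (- \<alpha>) 0) a"
proof -
  have pos: "sweep \<alpha> r = (if velocity f r \<le> \<alpha> then f r - \<alpha> * r else 0)" if "r \<in> {0..1}" for r \<alpha>
    using that velocity_le_iff[of r \<alpha>] by (cases "r = 0") (auto simp: sweep_def zero)
  have sweep_0: "sweep 0 r = 0" if "r \<in> {0..1}" for r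
    using nonneg[OF that] by (simp add: sweep_def)
  note v = velocity_nonneg[OF assms(1)] velocity_nonneg[OF assms(2)]
  consider "\<alpha> > 0" | "\<alpha> = 0" | "\<alpha> < 0" by linarith
  then show ?thesis
  proof cases
    case 1
    then show ?thesis using v pos[OF assms(2)] sweep_0[OF assms(1)]
      by (simp add: h_zero_def)
  next
    case 2
    then show ?thesis
      using v pos[OF assms(1), of 0] pos[OF assms(2), of 0] sweep_0[OF assms(1)] sweep_0[OF assms(2)]
      by (auto simp: h_zero_def split: if_splits)
  next
    case 3
    then show ?thesis using v pos[OF assms(1), of "- \<alpha>"] sweep_0[OF assms(2)]
      by (auto simp: h_zero_def)
  qed
qed

lemma h_zero_reflect:
  "a \<in> {0..1} \<Longrightarrow> b \<in> {0..1} \<Longrightarrow> h_zero f a b \<alpha> = - h_zero f b a (- \<alpha>)"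
  by (simp add: h_zero_eq)

lemma rem_L_eq:
  assumes "k \<in> {0..1}"
  shows "rem_L f k \<alpha> = f k + \<alpha> * k + h_zero f k k \<alpha>"
proof -
  \<comment> \<open>\<open>rem_L\<close> tests the lower threshold first and \<open>h_zero\<close>
    the upper one. Both hold together only when the velocity is 0, and then the branches
    agree.\<close>
  have "2 * f k = 0 \<and> f k - \<alpha> * k = - f k - \<alpha> * k" if "velocity f k \<le> \<alpha>" "\<alpha> \<le> - velocity f k"
  proof -
    have "velocity f k = 0" using that velocity_nonneg[OF assms] by linarith
    then show ?thesis by (cases "k = 0") (auto simp: velocity_def zero)
  qed
  then show ?thesis by (auto simp: rem_L_def h_zero_def)
qed

lemma rem_R_eq: "k \<in> {0..1} \<Longrightarrow> rem_R f k \<alpha> = rem_L f k (- \<alpha>)"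
  using h_zero_reflect[of k k \<alpha>] by (simp add: rem_R_def rem_L_eq)

text \<open>For \<alpha> \<ge> 0 the remainder is the minimum of f(k) + \<alpha>k and 2f(k); for
  \<alpha> \<le> 0 it is the positive part of f(k) + \<alpha>k.\<close>

lemma rem_L_nonneg:
  assumes "k \<in> {0..1}"
  shows "0 \<le> rem_L f k \<alpha>"
proof -
  have "\<alpha> \<ge> 0 \<Longrightarrow> 0 \<le> \<alpha> * k" "\<alpha> \<le> 0 \<Longrightarrow> \<alpha> * k \<le> 0"
    using assms by (auto simp: mult_nonpos_nonneg)
  then show ?thesis using nonneg[OF assms]
    unfolding rem_L_eq[OF assms] h_zero_eq[OF assms assms]
    by (cases "\<alpha> \<ge> 0") (auto simp: sweep_def min_def)
qed

end

section \<open>Monotone updates\<close>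

lemma max_diff_min: "D * max a k - D * min a k = D * \<bar>a - k\<bar>" for a k D :: real
  by (simp add: max_def min_def abs_if algebra_simps)

text \<open>The argument of Crandall and Majda: \<open>P\<close> and \<open>M\<close> are the values of a monotone update at the
  pointwise maximum and minimum of the data with \<open>k\<close>, and \<open>D * k - s\<close> is its value at
  the constant state \<open>k\<close>.\<close>

lemma entropy_of_monotone_update:
  fixes D M P s w k :: real
  assumes "0 < D" "0 \<le> s" "M \<le> D * w" "D * w \<le> P" "M \<le> D * k - s" "D * k - s \<le> P"
  shows "D * \<bar>w - k\<bar> \<le> P - M + s"
proof -
  have "D * \<bar>w - k\<bar> = \<bar>D * w - D * k\<bar>"
    using assms(1) by (simp flip: right_diff_distrib add: abs_mult)
  \<comment> \<open>For w < k the difference is at most P + s - M; for w \<ge> k it is at most P - M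
    - s, and the sign of \<open>s\<close> absorbs this case.\<close>
  then show ?thesis using assms by linarith
qed

locale cfl_flux = concave_flux +
  fixes \<delta> \<tau> :: real
  assumes delta_pos: "0 < \<delta>" and tau_pos: "0 < \<tau>" and cfl: "\<tau> * L \<le> \<delta> / 2"
begin

text \<open>Larger neighbours only help, by the monotonicity of the flux. The cell's own value
  enters two fluxes of slope at most \<open>L\<close> each, so 2\<tau>L \<le> \<delta> is what is
  required.\<close>

lemma std_update_mono:
  assumes "a \<in> {0..1}" "a' \<in> {0..1}" "c \<in> {0..1}" "c' \<in> {0..1}" "d \<in> {0..1}" "d' \<in> {0..1}"
    and le: "a \<le> a'" "c \<le> c'" "d \<le> d'"
  shows "\<delta> * a - \<tau> * (godunov f a d - godunov f c a)
       \<le> \<delta> * a' - \<tau> * (godunov f a' d' - godunov f c' a')"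
proof -
  have "godunov f a' d' - godunov f c' a' - (godunov f a d - godunov f c a) \<le> 2 * (L * (a' - a))"
    using godunov_right_antimono[OF lip assms(5,6,2) le(3)]
      godunov_left_lip[OF lip assms(1,2,5) le(1)]
      godunov_left_mono[OF lip assms(3,4,2) le(2)]
      godunov_right_lip[OF lip assms(1,2,3) le(1)] by linarith
  then have "\<tau> * (godunov f a' d' - godunov f c' a' - (godunov f a d - godunov f c a))
      \<le> \<tau> * (2 * (L * (a' - a)))"
    using tau_pos by (intro mult_left_mono) auto
  also have "\<dots> = (\<tau> * L) * (2 * (a' - a))" by simp
  also have "\<dots> \<le> \<delta> / 2 * (2 * (a' - a))" using cfl le by (intro mult_right_mono) auto
  finally show ?thesis by (simp add: algebra_simps)
qed

lemma std_update_entropy: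
  assumes "a \<in> {0..1}" "c \<in> {0..1}" "d \<in> {0..1}" "k \<in> {0..1}"
    and w: "w = a - \<tau> / \<delta> * (godunov f a d - godunov f c a)"
  shows "\<delta> * \<bar>w - k\<bar> \<le> \<delta> * \<bar>a - k\<bar>
    - \<tau> * ((godunov f (max a k) (max d k) - godunov f (min a k) (min d k))
         - (godunov f (max c k) (max a k) - godunov f (min c k) (min a k)))"
proof -
  let ?G = "\<lambda>a c d. \<delta> * a - \<tau> * (godunov f a d - godunov f c a)"
  have w': "\<delta> * w = ?G a c d" using w delta_pos by (simp add: field_simps)
  have "?G (min a k) (min c k) (min d k) \<le> ?G a c d" "?G a c d \<le> ?G (max a k) (max c k) (max d k)"
    "?G (min a k) (min c k) (min d k) \<le> ?G k k k" "?G k k k \<le> ?G (max a k) (max c k) (max d k)"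
    by (rule std_update_mono; use assms in auto)+
  \<comment> \<open>Away from the interface constants are preserved, so the defect is 0.\<close>
  moreover have "?G k k k = \<delta> * k - 0" by simp
  ultimately have "\<delta> * \<bar>w - k\<bar> \<le> ?G (max a k) (max c k) (max d k) - ?G (min a k) (min c k) (min d k) + 0"
    unfolding w'[symmetric] by (intro entropy_of_monotone_update[OF delta_pos]) (simp_all only: order_refl)
  then show ?thesis
    unfolding max_diff_min[of \<delta> a k, symmetric] by (simp add: right_diff_distrib)
qed

lemma std_update_range:
  assumes "a \<in> {0..1}" "c \<in> {0..1}" "d \<in> {0..1}"
    and w: "w = a - \<tau> / \<delta> * (godunov f a d - godunov f c a)"
  shows "w \<in> {0..1}"
proof -
  have w': "\<delta> * w = \<delta> * a - \<tau> * (godunov f a d - godunov f c a)"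
    using w delta_pos by (simp add: field_simps)
  have "\<delta> * 0 \<le> \<delta> * w" "\<delta> * w \<le> \<delta> * 1"
    unfolding w' using std_update_mono[of 0 a 0 c 0 d] std_update_mono[of a 1 c 1 d 1] assms by auto
  then show ?thesis using delta_pos by (simp add: zero_le_mult_iff)
qed

text \<open>\<open>h_zero\<close> and the outer Godunov flux both depend on \<open>a\<close>, and their Lipschitz constants add up to
  $2L + |\alpha|$, too much for the CFL condition. But where \<open>h_zero\<close> depends on \<open>a\<close> it contributes \<open>- f a\<close>,
  which compensates the growth of the Godunov flux (\<open>godunov_left_slope\<close>).\<close>

lemma front_flux_mono:
  assumes "a \<in> {0..1}" "a' \<in> {0..1}" "b \<in> {0..1}" "b' \<in> {0..1}" "c \<in> {0..1}" "c' \<in> {0..1}"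
    and le: "a \<le> a'" "b \<le> b'" "c \<le> c'"
  shows "h_zero f a' b' \<alpha> + godunov f a' c'
     \<le> h_zero f a b \<alpha> + godunov f a c + (L + \<bar>\<alpha>\<bar>) * (a' - a)"
proof -
  define \<beta> where "\<beta> = max (- \<alpha>) 0"
  have \<beta>: "0 \<le> \<beta> * (a' - a)" "\<beta> * (a' - a) \<le> \<bar>\<alpha>\<bar> * (a' - a)"
    using le by (auto simp: \<beta>_def intro!: mult_right_mono)
  have "godunov f a' c - sweep \<beta> a' \<le> godunov f a c - sweep \<beta> a + L * (a' - a) + \<beta> * (a' - a)"
  \<comment> \<open>In the first case both sweeps are 0 and the plain Lipschitz bound is enough. In
    the second, the change f(a') - f(a) in \<open>sweep\<close> cancels the one in the slope
    bound.\<close>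
  proof (cases "f a' - \<beta> * a' \<ge> 0")
    case True
    have "sweep \<beta> a' \<le> sweep \<beta> a" using assms by (intro sweep_antimono) auto
    then have "sweep \<beta> a' = sweep \<beta> a" using True by (simp add: sweep_def min_def split: if_splits)
    then show ?thesis using godunov_left_lip[OF lip assms(1,2,5) le(1)] \<beta> by linarith
  next
    case False
    then have "sweep \<beta> a - sweep \<beta> a' \<le> f a - f a' + \<beta> * (a' - a)"
      by (simp add: sweep_def algebra_simps)
    then show ?thesis using godunov_left_slope[OF lip assms(1,2,5) le(1)] by linarith
  qed
  moreover have "sweep (max \<alpha> 0) b' \<le> sweep (max \<alpha> 0) b"
    using assms by (intro sweep_antimono) auto
  moreover have "godunov f a' c' \<le> godunov f a' c"
    by (rule godunov_right_antimono[OF lip assms(5,6,2) le(3)])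
  ultimately show ?thesis
    using \<beta> assms by (simp add: h_zero_eq \<beta>_def[symmetric] distrib_right)
qed

text \<open>The flux speed and the interface speed use \<delta>/2 each, which together the cell
  length \<Delta> \<ge> \<delta> can pay for.\<close>

lemma front_update_mono:
  assumes "a \<in> {0..1}" "a' \<in> {0..1}" "b \<in> {0..1}" "b' \<in> {0..1}" "c \<in> {0..1}" "c' \<in> {0..1}"
    and le: "a \<le> a'" "b \<le> b'" "c \<le> c'"
    and size: "\<delta> \<le> \<Delta>" "\<tau> * \<bar>\<alpha>\<bar> \<le> \<delta> / 2"
  shows "\<Delta> * a - \<tau> * (h_zero f a b \<alpha> + godunov f a c)
       \<le> \<Delta> * a' - \<tau> * (h_zero f a' b' \<alpha> + godunov f a' c')"
proof -
  have "\<tau> * (h_zero f a' b' \<alpha> + godunov f a' c' - (h_zero f a b \<alpha> + godunov f a c))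
      \<le> \<tau> * ((L + \<bar>\<alpha>\<bar>) * (a' - a))"
    using tau_pos front_flux_mono[OF assms(1-9), of \<alpha>] by (intro mult_left_mono) auto
  also have "\<dots> = (\<tau> * L + \<tau> * \<bar>\<alpha>\<bar>) * (a' - a)" by (simp add: algebra_simps)
  also have "\<dots> \<le> \<Delta> * (a' - a)" using cfl size le by (intro mult_right_mono) auto
  finally show ?thesis by (simp add: algebra_simps)
qed

text \<open>After absorption the interface flux depends on \<open>a\<close> and the outer flux on
  \<open>d\<close>, so each is paid for by the length of its own cell.\<close>

lemma merged_update_mono:
  assumes "a \<in> {0..1}" "a' \<in> {0..1}" "b \<in> {0..1}" "b' \<in> {0..1}"
    "c \<in> {0..1}" "c' \<in> {0..1}" "d \<in> {0..1}" "d' \<in> {0..1}"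
    and le: "a \<le> a'" "b \<le> b'" "c \<le> c'" "d \<le> d'"
    and size: "\<delta> \<le> \<Delta>" "\<tau> * \<bar>\<alpha>\<bar> \<le> \<delta> / 2"
  shows "\<Delta> * a + \<delta> * d - \<tau> * (h_zero f a b \<alpha> + godunov f d c)
       \<le> \<Delta> * a' + \<delta> * d' - \<tau> * (h_zero f a' b' \<alpha> + godunov f d' c')"
proof -
  have "h_zero f a' b' \<alpha> - h_zero f a b \<alpha> \<le> (L + \<bar>\<alpha>\<bar>) * (a' - a)"
    \<comment> \<open>With outer state 0 on both sides the Godunov terms differ by a nonnegative
      amount; dropping it isolates the slope of \<open>h_zero\<close>.\<close>
    using front_flux_mono[of a a' b b' 0 0 \<alpha>] godunov_left_mono[OF lip, of a a' 0] assms by auto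
  moreover have "godunov f d' c' \<le> godunov f d c + L * (d' - d)"
    using godunov_right_antimono[OF lip assms(5,6,8) le(3)]
      godunov_left_lip[OF lip assms(7,8,5) le(4)] by linarith
  ultimately have "\<tau> * (h_zero f a' b' \<alpha> + godunov f d' c' - (h_zero f a b \<alpha> + godunov f d c))
      \<le> \<tau> * ((L + \<bar>\<alpha>\<bar>) * (a' - a) + L * (d' - d))"
    using tau_pos by (intro mult_left_mono) auto
  also have "\<dots> = (\<tau> * L + \<tau> * \<bar>\<alpha>\<bar>) * (a' - a) + (\<tau> * L) * (d' - d)" by (simp add: algebra_simps)
  also have "\<dots> \<le> \<Delta> * (a' - a) + \<delta> * (d' - d)"
    using cfl size le delta_pos by (intro add_mono mult_right_mono) auto
  finally show ?thesis by (simp add: algebra_simps)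
qed

lemma front_update_const:
  assumes "k \<in> {0..1}" "D = \<Delta> + \<tau> * \<alpha>"
  shows "\<Delta> * k - \<tau> * (h_zero f k k \<alpha> + godunov f k k) = D * k - \<tau> * rem_L f k \<alpha>"
  by (simp add: rem_L_eq[OF assms(1)] assms(2) godunov_same algebra_simps)

lemma front_update_entropy:
  assumes range: "a \<in> {0..1}" "b \<in> {0..1}" "c \<in> {0..1}" "k \<in> {0..1}"
    and size: "\<delta> \<le> \<Delta>" "\<tau> * \<bar>\<alpha>\<bar> \<le> \<delta> / 2"
    and D: "D = \<Delta> + \<tau> * \<alpha>" "0 < D"
    and w: "D * w = \<Delta> * a - \<tau> * (h_zero f a b \<alpha> + godunov f a c)"
  shows "D * \<bar>w - k\<bar> \<le> \<Delta> * \<bar>a - k\<bar>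
    - \<tau> * (entropy_flux_zero f k a b \<alpha>
         + (godunov f (max a k) (max c k) - godunov f (min a k) (min c k))) + \<tau> * rem_L f k \<alpha>"
proof -
  let ?G = "\<lambda>a b c. \<Delta> * a - \<tau> * (h_zero f a b \<alpha> + godunov f a c)"
  have "?G (min a k) (min b k) (min c k) \<le> ?G a b c" "?G a b c \<le> ?G (max a k) (max b k) (max c k)"
    "?G (min a k) (min b k) (min c k) \<le> ?G k k k" "?G k k k \<le> ?G (max a k) (max b k) (max c k)"
    by (rule front_update_mono; use range size in auto)+
  note G = this[folded w, unfolded front_update_const[OF range(4) D(1)]]
  have "0 \<le> \<tau> * rem_L f k \<alpha>" using tau_pos rem_L_nonneg[OF range(4)] by simp
  from entropy_of_monotone_update[OF D(2) this G]
  show ?thesis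
    unfolding max_diff_min[of \<Delta> a k, symmetric] entropy_flux_zero_def
    by (simp add: right_diff_distrib distrib_left)
qed

lemma merged_update_entropy:
  assumes range: "a \<in> {0..1}" "b \<in> {0..1}" "c \<in> {0..1}" "d \<in> {0..1}" "k \<in> {0..1}"
    and size: "\<delta> \<le> \<Delta>" "\<tau> * \<bar>\<alpha>\<bar> \<le> \<delta> / 2"
    and D: "D = \<Delta> + \<delta> + \<tau> * \<alpha>" "0 < D"
    and w: "D * w = \<Delta> * a + \<delta> * d - \<tau> * (h_zero f a b \<alpha> + godunov f d c)"
  shows "D * \<bar>w - k\<bar> \<le> \<Delta> * \<bar>a - k\<bar> + \<delta> * \<bar>d - k\<bar>
    - \<tau> * (entropy_flux_zero f k a b \<alpha>
         + (godunov f (max d k) (max c k) - godunov f (min d k) (min c k))) + \<tau> * rem_L f k \<alpha>"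
proof -
  let ?G = "\<lambda>a b c d. \<Delta> * a + \<delta> * d - \<tau> * (h_zero f a b \<alpha> + godunov f d c)"
  have const: "?G k k k k = D * k - \<tau> * rem_L f k \<alpha>"
    \<comment> \<open>For equal states the two old cells act as a single cell of length \<Delta> +
      \<delta>.\<close>
    using front_update_const[OF range(5), of D "\<Delta> + \<delta>" \<alpha>] D by (simp add: algebra_simps)
  have "?G (min a k) (min b k) (min c k) (min d k) \<le> ?G a b c d"
    "?G a b c d \<le> ?G (max a k) (max b k) (max c k) (max d k)"
    "?G (min a k) (min b k) (min c k) (min d k) \<le> ?G k k k k"
    "?G k k k k \<le> ?G (max a k) (max b k) (max c k) (max d k)"
    by (rule merged_update_mono; use range size in auto)+
  note G = this[folded w, unfolded const]
  have "0 \<le> \<tau> * rem_L f k \<alpha>" using tau_pos rem_L_nonneg[OF range(5)] by simp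
  from entropy_of_monotone_update[OF D(2) this G]
  show ?thesis
    unfolding max_diff_min[of \<Delta> a k, symmetric] max_diff_min[of \<delta> d k, symmetric]
      entropy_flux_zero_def
    by (simp add: right_diff_distrib distrib_left)
qed

lemma front_update_range:
  assumes range: "a \<in> {0..1}" "b \<in> {0..1}" "c \<in> {0..1}"
    and size: "\<delta> \<le> \<Delta>" "\<tau> * \<bar>\<alpha>\<bar> \<le> \<delta> / 2"
    and D: "D = \<Delta> + \<tau> * \<alpha>" "0 < D"
    and w: "D * w = \<Delta> * a - \<tau> * (h_zero f a b \<alpha> + godunov f a c)"
  shows "w \<in> {0..1}"
proof -
  let ?G = "\<lambda>a b c. \<Delta> * a - \<tau> * (h_zero f a b \<alpha> + godunov f a c)"
  have const: "?G k k k = D * k - \<tau> * rem_L f k \<alpha>" if "k \<in> {0..1}" for k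
    by (rule front_update_const[OF that D(1)])
  have "?G 0 0 0 \<le> D * w" "D * w \<le> ?G 1 1 1"
    unfolding w by (rule front_update_mono; use range size in auto)+
  \<comment> \<open>The state 0 is preserved exactly, while 1 may only lose mass.\<close>
  moreover have "rem_L f 0 \<alpha> = 0" by (simp add: rem_L_def zero)
  moreover have "0 \<le> \<tau> * rem_L f 1 \<alpha>" using rem_L_nonneg[of 1 \<alpha>] tau_pos by simp
  ultimately have "D * 0 \<le> D * w" "D * w \<le> D * 1" using const[of 0] const[of 1] by auto
  then show ?thesis using D(2) by (simp add: zero_le_mult_iff)
qed

lemma merged_update_range:
  assumes range: "a \<in> {0..1}" "b \<in> {0..1}" "c \<in> {0..1}" "d \<in> {0..1}"
    and size: "\<delta> \<le> \<Delta>" "\<tau> * \<bar>\<alpha>\<bar> \<le> \<delta> / 2"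
    and D: "D = \<Delta> + \<delta> + \<tau> * \<alpha>" "0 < D"
    and w: "D * w = \<Delta> * a + \<delta> * d - \<tau> * (h_zero f a b \<alpha> + godunov f d c)"
  shows "w \<in> {0..1}"
proof -
  let ?G = "\<lambda>a b c d. \<Delta> * a + \<delta> * d - \<tau> * (h_zero f a b \<alpha> + godunov f d c)"
  have const: "?G k k k k = D * k - \<tau> * rem_L f k \<alpha>" if "k \<in> {0..1}" for k
    using front_update_const[OF that, of D "\<Delta> + \<delta>" \<alpha>] D by (simp add: algebra_simps)
  have "?G 0 0 0 0 \<le> D * w" "D * w \<le> ?G 1 1 1 1"
    unfolding w
    by (rule merged_update_mono; use range size in auto)+
  moreover have "rem_L f 0 \<alpha> = 0" by (simp add: rem_L_def zero)
  moreover have "0 \<le> \<tau> * rem_L f 1 \<alpha>" using rem_L_nonneg[of 1 \<alpha>] tau_pos by simp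
  ultimately have "D * 0 \<le> D * w" "D * w \<le> D * 1" using const[of 0] const[of 1] by auto
  then show ?thesis using D(2) by (simp add: zero_le_mult_iff)
qed

lemma entropy_flux_zero_reflect:
  assumes "a \<in> {0..1}" "b \<in> {0..1}" "k \<in> {0..1}"
  shows "entropy_flux_zero f k a b \<alpha> = - entropy_flux_zero f k b a (- \<alpha>)"
proof -
  have "max a k \<in> {0..1}" "max b k \<in> {0..1}" "min a k \<in> {0..1}" "min b k \<in> {0..1}"
    using assms by auto
  then show ?thesis
    unfolding entropy_flux_zero_def
    by (simp only: h_zero_reflect[of "max a k" "max b k" \<alpha>] h_zero_reflect[of "min a k" "min b k" \<alpha>])
qed

section \<open>Updates in terms of \<open>h_minus\<close> and \<open>h_plus\<close> on either side
  of the interface\<close>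

lemma std_minus_range:
  "std_update (h_minus f) \<delta> \<tau> u w j \<Longrightarrow> u j \<in> {0..1} \<Longrightarrow> u (j - 1) \<in> {0..1} \<Longrightarrow> u (j + 1) \<in> {0..1}
    \<Longrightarrow> w j \<in> {0..1}"
  by (rule std_update_range[of "u j" "u (j + 1)" "u (j - 1)"]) (auto simp: std_update_def h_minus_eq)

lemma std_plus_range:
  "std_update (h_plus f) \<delta> \<tau> u w j \<Longrightarrow> u j \<in> {0..1} \<Longrightarrow> u (j - 1) \<in> {0..1} \<Longrightarrow> u (j + 1) \<in> {0..1}
    \<Longrightarrow> w j \<in> {0..1}"
  by (rule std_update_range[of "u j" "u (j - 1)" "u (j + 1)"]) (auto simp: std_update_def h_plus_def)

lemma std_minus_entropy:
  assumes "std_update (h_minus f) \<delta> \<tau> u w j" "u j \<in> {0..1}" "u (j - 1) \<in> {0..1}" "u (j + 1) \<in> {0..1}"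
    and "k \<in> {0..1}"
  shows "entropy_ineq (h_minus f) \<delta> \<tau> k u w j"
proof -
  \<comment> \<open>Left of the interface the flux is mirrored, so \<open>u (j - 1)\<close> takes
    the downstream role and \<open>u (j + 1)\<close> the upstream one.\<close>
  have "w j = u j - \<tau> / \<delta> * (godunov f (u j) (u (j - 1)) - godunov f (u (j + 1)) (u j))"
    using assms(1) by (simp add: std_update_def h_minus_eq)
  from std_update_entropy[OF assms(2,4,3,5) this] show ?thesis
    by (simp add: entropy_ineq_def entropy_flux_def h_minus_eq algebra_simps)
qed

lemma std_plus_entropy:
  assumes "std_update (h_plus f) \<delta> \<tau> u w j" "u j \<in> {0..1}" "u (j - 1) \<in> {0..1}" "u (j + 1) \<in> {0..1}"
    and "k \<in> {0..1}"
  shows "entropy_ineq (h_plus f) \<delta> \<tau> k u w j"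
proof -
  have "w j = u j - \<tau> / \<delta> * (godunov f (u j) (u (j + 1)) - godunov f (u (j - 1)) (u j))"
    using assms(1) by (simp add: std_update_def h_plus_def)
  from std_update_entropy[OF assms(2,3,4,5) this] show ?thesis
    by (simp add: entropy_ineq_def entropy_flux_def h_plus_def)
qed

lemma left_range:
  assumes "a \<in> {0..1}" "b \<in> {0..1}" "c \<in> {0..1}" "\<delta> \<le> \<Delta>" "\<tau> * \<bar>\<alpha>\<bar> \<le> \<delta> / 2" "D = \<Delta> + \<tau> * \<alpha>" "0 < D"
    and "D * w = \<Delta> * a - \<tau> * (h_zero f a b \<alpha> - h_minus f c a)"
  shows "w \<in> {0..1}"
  by (rule front_update_range[OF assms(1-7)]) (simp add: assms(8) h_minus_eq)

lemma left_entropy: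
  assumes "a \<in> {0..1}" "b \<in> {0..1}" "c \<in> {0..1}" "k \<in> {0..1}"
    "\<delta> \<le> \<Delta>" "\<tau> * \<bar>\<alpha>\<bar> \<le> \<delta> / 2" "D = \<Delta> + \<tau> * \<alpha>" "0 < D"
    and "D * w = \<Delta> * a - \<tau> * (h_zero f a b \<alpha> - h_minus f c a)"
  shows "D * \<bar>w - k\<bar> \<le> \<Delta> * \<bar>a - k\<bar> - \<tau> * (entropy_flux_zero f k a b \<alpha>
    - (h_minus f (max c k) (max a k) - h_minus f (min c k) (min a k))) + \<tau> * rem_L f k \<alpha>"
proof -
  have "D * w = \<Delta> * a - \<tau> * (h_zero f a b \<alpha> + godunov f a c)"
    by (simp add: assms(9) h_minus_eq)
  from front_update_entropy[OF assms(1-8) this] show ?thesis by (simp add: h_minus_eq algebra_simps)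
qed

lemma left_merged_range:
  assumes "a \<in> {0..1}" "b \<in> {0..1}" "c \<in> {0..1}" "d \<in> {0..1}" "\<delta> \<le> \<Delta>" "\<tau> * \<bar>\<alpha>\<bar> \<le> \<delta> / 2"
    "D = \<Delta> + \<delta> + \<tau> * \<alpha>" "0 < D"
    and "D * w = \<Delta> * a + \<delta> * d - \<tau> * (h_zero f a b \<alpha> - h_minus f c d)"
  shows "w \<in> {0..1}"
  by (rule merged_update_range[OF assms(1-8)]) (simp add: assms(9) h_minus_eq)

lemma left_merged_entropy:
  assumes "a \<in> {0..1}" "b \<in> {0..1}" "c \<in> {0..1}" "d \<in> {0..1}" "k \<in> {0..1}"
    "\<delta> \<le> \<Delta>" "\<tau> * \<bar>\<alpha>\<bar> \<le> \<delta> / 2" "D = \<Delta> + \<delta> + \<tau> * \<alpha>" "0 < D"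
    and "D * w = \<Delta> * a + \<delta> * d - \<tau> * (h_zero f a b \<alpha> - h_minus f c d)"
  shows "D * \<bar>w - k\<bar> \<le> \<Delta> * \<bar>a - k\<bar> + \<delta> * \<bar>d - k\<bar> - \<tau> * (entropy_flux_zero f k a b \<alpha>
    - (h_minus f (max c k) (max d k) - h_minus f (min c k) (min d k))) + \<tau> * rem_L f k \<alpha>"
proof -
  have "D * w = \<Delta> * a + \<delta> * d - \<tau> * (h_zero f a b \<alpha> + godunov f d c)"
    by (simp add: assms(10) h_minus_eq)
  from merged_update_entropy[OF assms(1-9) this] show ?thesis by (simp add: h_minus_eq algebra_simps)
qed

lemma right_range:
  assumes "a \<in> {0..1}" "b \<in> {0..1}" "c \<in> {0..1}" "\<delta> \<le> \<Delta>" "\<tau> * \<bar>\<alpha>\<bar> \<le> \<delta> / 2"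
    and D: "D = \<Delta> - \<tau> * \<alpha>" "0 < D"
    and w: "D * w = \<Delta> * b - \<tau> * (h_plus f b c - h_zero f a b \<alpha>)"
  shows "w \<in> {0..1}"
proof -
  have "D * w = \<Delta> * b - \<tau> * (h_zero f b a (- \<alpha>) + godunov f b c)"
    by (simp add: w h_plus_def h_zero_reflect[OF assms(1,2)] add.commute)
  from front_update_range[OF assms(2,1,3,4) _ _ D(2) this] show ?thesis using assms(5) D(1) by simp
qed

lemma right_entropy:
  assumes "a \<in> {0..1}" "b \<in> {0..1}" "c \<in> {0..1}" "k \<in> {0..1}" "\<delta> \<le> \<Delta>" "\<tau> * \<bar>\<alpha>\<bar> \<le> \<delta> / 2"
    and D: "D = \<Delta> - \<tau> * \<alpha>" "0 < D"
    and w: "D * w = \<Delta> * b - \<tau> * (h_plus f b c - h_zero f a b \<alpha>)"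
  shows "D * \<bar>w - k\<bar> \<le> \<Delta> * \<bar>b - k\<bar>
    - \<tau> * ((h_plus f (max b k) (max c k) - h_plus f (min b k) (min c k))
         - entropy_flux_zero f k a b \<alpha>) + \<tau> * rem_R f k \<alpha>"
proof -
  have "D * w = \<Delta> * b - \<tau> * (h_zero f b a (- \<alpha>) + godunov f b c)"
    by (simp add: w h_plus_def h_zero_reflect[OF assms(1,2)] add.commute)
  from front_update_entropy[OF assms(2,1,3-5) _ _ D(2) this] show ?thesis
    using assms(6) D(1)
    by (simp add: h_plus_def entropy_flux_zero_reflect[OF assms(1,2,4)] rem_R_eq[OF assms(4)] add.commute)
qed

lemma right_merged_range:
  assumes "a \<in> {0..1}" "b \<in> {0..1}" "c \<in> {0..1}" "d \<in> {0..1}" "\<delta> \<le> \<Delta>" "\<tau> * \<bar>\<alpha>\<bar> \<le> \<delta> / 2"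
    and D: "D = \<Delta> + \<delta> - \<tau> * \<alpha>" "0 < D"
    and w: "D * w = \<Delta> * b + \<delta> * d - \<tau> * (h_plus f d c - h_zero f a b \<alpha>)"
  shows "w \<in> {0..1}"
proof -
  have "D * w = \<Delta> * b + \<delta> * d - \<tau> * (h_zero f b a (- \<alpha>) + godunov f d c)"
    by (simp add: w h_plus_def h_zero_reflect[OF assms(1,2)] add.commute)
  from merged_update_range[OF assms(2,1,3-5) _ _ D(2) this] show ?thesis using assms(6) D(1) by simp
qed

lemma right_merged_entropy:
  assumes "a \<in> {0..1}" "b \<in> {0..1}" "c \<in> {0..1}" "d \<in> {0..1}" "k \<in> {0..1}"
    "\<delta> \<le> \<Delta>" "\<tau> * \<bar>\<alpha>\<bar> \<le> \<delta> / 2"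
    and D: "D = \<Delta> + \<delta> - \<tau> * \<alpha>" "0 < D"
    and w: "D * w = \<Delta> * b + \<delta> * d - \<tau> * (h_plus f d c - h_zero f a b \<alpha>)"
  shows "D * \<bar>w - k\<bar> \<le> \<Delta> * \<bar>b - k\<bar> + \<delta> * \<bar>d - k\<bar>
    - \<tau> * ((h_plus f (max d k) (max c k) - h_plus f (min d k) (min c k))
         - entropy_flux_zero f k a b \<alpha>) + \<tau> * rem_R f k \<alpha>"
proof -
  have "D * w = \<Delta> * b + \<delta> * d - \<tau> * (h_zero f b a (- \<alpha>) + godunov f d c)"
    by (simp add: w h_plus_def h_zero_reflect[OF assms(1,2)] add.commute)
  from merged_update_entropy[OF assms(2,1,3-6) _ _ D(2) this] show ?thesis
    using assms(7) D(1)
    by (simp add: h_plus_def entropy_flux_zero_reflect[OF assms(1,2,5)] rem_R_eq[OF assms(5)] add.commute)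
qed

end

section \<open>Geometry of the moving mesh\<close>

text \<open>The half-open cells tile the line, and the index is the floor of \<xi>/\<delta> + 1/2;
  existence and uniqueness justify the definite description in \<open>tp_index\<close>.\<close>

lemma tp_index_cell:
  assumes "0 < \<delta>"
  shows "\<xi> (real n * \<tau>) \<in> fixed_cell \<delta> (tp_index \<xi> \<delta> \<tau> n)"
  unfolding tp_index_def
proof (rule theI')
  let ?x = "\<xi> (real n * \<tau>) / \<delta> + 1 / 2"
  have "\<xi> (real n * \<tau>) \<in> fixed_cell \<delta> j \<longleftrightarrow> j = \<lfloor>?x\<rfloor>" for j
  proof -
    have "\<xi> (real n * \<tau>) \<in> fixed_cell \<delta> j \<longleftrightarrow> of_int j \<le> ?x \<and> ?x < of_int j + 1"
      using assms by (auto simp: fixed_cell_def node_def field_simps)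
    then show ?thesis by (auto simp: eq_commute[of j] floor_eq_iff)
  qed
  then show "\<exists>!j. \<xi> (real n * \<tau>) \<in> fixed_cell \<delta> j" by simp
qed

locale moving_mesh = cfl_flux f L \<delta> \<tau> for f L \<delta> \<tau> +
  fixes \<xi> :: "real \<Rightarrow> real" and N :: nat
  assumes delta_eq: "\<delta> = 1 / 2 ^ N"
    and inside: "\<And>n. \<bar>\<xi> (real n * \<tau>)\<bar> < 1 - \<delta> / 2"
    and slow: "\<And>n. \<bar>\<xi> (real (n + 1) * \<tau>) - \<xi> (real n * \<tau>)\<bar> \<le> \<delta> / 2"
begin

abbreviation "x\<^sub>t n \<equiv> \<xi> (real n * \<tau>)"
abbreviation "front \<equiv> tp_index \<xi> \<delta> \<tau>"
abbreviation "slope \<equiv> tp_slope \<xi> \<tau>"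

lemma front_bounds: "(of_int (front n) - 1 / 2) * \<delta> \<le> x\<^sub>t n" "x\<^sub>t n < (of_int (front n) + 1 / 2) * \<delta>"
  using tp_index_cell[OF delta_pos, of \<xi> n \<tau>] by (auto simp: fixed_cell_def node_def)

text \<open>1 - \<delta>/2 is the left endpoint of the cell with index \<open>2 ^ N\<close>, and its
  negative the right endpoint of the opposite cell; the interface stays strictly between
  them.\<close>

lemma front_range: "- (2 ^ N) < front n" "front n < 2 ^ N"
proof -
  have d: "1 = 2 ^ N * \<delta>" by (simp add: delta_eq)
  have "(of_int (front n) - 1 / 2) * \<delta> < (2 ^ N - 1 / 2) * \<delta>"
    using front_bounds(1)[of n] inside[of n] d by (simp add: algebra_simps)
  then have "real_of_int (front n) < of_int (2 ^ N)" using delta_pos by simp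
  then show "front n < 2 ^ N" by (simp only: of_int_less_iff)
  have "(- (2 ^ N) + 1 / 2) * \<delta> < (of_int (front n) + 1 / 2) * \<delta>"
    using front_bounds(2)[of n] inside[of n] d by (simp add: algebra_simps)
  then have "of_int (- (2 ^ N)) < real_of_int (front n)" using delta_pos by simp
  then show "- (2 ^ N) < front n" by (simp only: of_int_less_iff)
qed

text \<open>Points at most half a cell apart lie in equal or adjacent cells. The real bound 2 on the
  index change is not sharp, but for integers a strict bound by 2 is enough.\<close>

lemma front_step: "front (n + 1) = front n \<or> front (n + 1) = front n + 1 \<or> front (n + 1) = front n - 1"
proof -
  have near: "x\<^sub>t (n + 1) \<le> x\<^sub>t n + \<delta> / 2" "x\<^sub>t n \<le> x\<^sub>t (n + 1) + \<delta> / 2"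
    using slow[of n] by linarith+
  have "real_of_int (front (n + 1)) * \<delta> < (of_int (front n) + 2) * \<delta>"
    using front_bounds(1)[of "n + 1"] front_bounds(2)[of n] near delta_pos
    by (auto simp: algebra_simps)
  moreover have "(real_of_int (front n) - 2) * \<delta> < of_int (front (n + 1)) * \<delta>"
    using front_bounds(2)[of "n + 1"] front_bounds(1)[of n] near delta_pos
    by (auto simp: algebra_simps)
  ultimately show ?thesis using delta_pos by simp linarith
qed

lemma size_L_eq: "size_L \<xi> \<delta> \<tau> n = x\<^sub>t n - (of_int (front n) - 3 / 2) * \<delta>"
  using front_bounds[of n] delta_pos
  by (simp add: size_L_def cell_L_def node_def algebra_simps)

lemma size_R_eq: "size_R \<xi> \<delta> \<tau> n = (of_int (front n) + 3 / 2) * \<delta> - x\<^sub>t n"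
  using front_bounds[of n] delta_pos
  by (simp add: size_R_def cell_R_def node_def algebra_simps)

lemma size_ge: "\<delta> \<le> size_L \<xi> \<delta> \<tau> n" "\<delta> \<le> size_R \<xi> \<delta> \<tau> n"
  using front_bounds[of n] delta_pos by (auto simp: size_L_eq size_R_eq algebra_simps)

lemma tau_slope: "\<tau> * slope n = x\<^sub>t (n + 1) - x\<^sub>t n"
  using tau_pos by (simp add: tp_slope_def)

lemma tau_slope_le: "\<tau> * \<bar>slope n\<bar> \<le> \<delta> / 2"
  using slow[of n] tau_pos tau_slope[of n] by (metis abs_mult abs_of_pos)

text \<open>The range includes one ghost index on each side, read by the updates at the outermost
  cells. The front index is excluded because the scheme leaves its value undetermined.\<close>

definition admissible :: "nat \<Rightarrow> (int \<Rightarrow> real) \<Rightarrow> bool" where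
  "admissible n u \<longleftrightarrow> (\<forall>j\<in>{- (2 ^ N) - 1..2 ^ N + 1} - {front n}. u j \<in> {0..1})"

lemma admissibleD:
  "admissible n u \<Longrightarrow> - (2 ^ N) - 1 \<le> j \<Longrightarrow> j \<le> 2 ^ N + 1 \<Longrightarrow> j \<noteq> front n \<Longrightarrow> u j \<in> {0..1}"
  by (simp add: admissible_def)

end

lemma average_range:
  assumes "A \<in> sets M" "emeasure M A < \<infinity>" "AE x in M. g x \<in> {0..1}"
  shows "(LINT x:A|M. g x) / measure M A \<in> {0..1}"
proof -
  have "0 \<le> (LINT x:A|M. g x)"
    unfolding set_lebesgue_integral_def using assms(3)
    by (intro integral_nonneg_AE) (auto simp: indicator_def)
  moreover have "(LINT x:A|M. g x) \<le> measure M A"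
  proof (cases "integrable M (\<lambda>x. indicator A x *\<^sub>R g x)")
    case True
    have "integrable M (indicator A :: _ \<Rightarrow> real)"
      using assms by (intro integrable_real_indicator) auto
    then have "(LINT x:A|M. g x) \<le> (LINT x|M. indicator A x)"
      unfolding set_lebesgue_integral_def using assms
      by (intro integral_mono_AE True) (auto split: split_indicator)
    also have "\<dots> = measure M A" using assms(1) sets.sets_into_space by (simp add: Int_absorb2)
    finally show ?thesis .
  \<comment> \<open>A non-integrable function has integral 0 by convention, which respects the
    bound; likewise the quotient below is 0 when the measure vanishes.\<close>
  qed (simp add: set_lebesgue_integral_def not_integrable_integral_eq)
  ultimately show ?thesis by (simp add: divide_le_eq)
qed

section \<open>One step of the scheme\<close>

context moving_mesh
begin

lemma scheme_step_stay:
  assumes "scheme_step f \<xi> N \<tau> n u w" "front (n + 1) = front n"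
  shows "\<And>j. - (2 ^ N) \<le> j \<Longrightarrow> j \<le> front n - 2 \<Longrightarrow> std_update (h_minus f) \<delta> \<tau> u w j"
    and "\<And>j. front n + 2 \<le> j \<Longrightarrow> j \<le> 2 ^ N \<Longrightarrow> std_update (h_plus f) \<delta> \<tau> u w j"
    and "size_L \<xi> \<delta> \<tau> (n + 1) * w (front n - 1) = size_L \<xi> \<delta> \<tau> n * u (front n - 1)
      - \<tau> * (h_zero f (u (front n - 1)) (u (front n + 1)) (slope n)
           - h_minus f (u (front n - 2)) (u (front n - 1)))"
    and "size_R \<xi> \<delta> \<tau> (n + 1) * w (front n + 1) = size_R \<xi> \<delta> \<tau> n * u (front n + 1)
      - \<tau> * (h_plus f (u (front n + 1)) (u (front n + 2))
           - h_zero f (u (front n - 1)) (u (front n + 1)) (slope n))"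
  using assms unfolding scheme_step_def Let_def delta_eq[symmetric] by auto

text \<open>Indices are relative to the old front m: the two new cells sharing one value have
  indices m - 1 and m, and the new right cell has index m + 2.\<close>

lemma scheme_step_right:
  assumes "scheme_step f \<xi> N \<tau> n u w" "front (n + 1) = front n + 1"
  shows "\<And>j. - (2 ^ N) \<le> j \<Longrightarrow> j \<le> front n - 2 \<Longrightarrow> std_update (h_minus f) \<delta> \<tau> u w j"
    and "\<And>j. front n + 3 \<le> j \<Longrightarrow> j \<le> 2 ^ N \<Longrightarrow> std_update (h_plus f) \<delta> \<tau> u w j"
    and "w (front n - 1) = w (front n)"
    and "(size_L \<xi> \<delta> \<tau> (n + 1) + \<delta>) * w (front n) = size_L \<xi> \<delta> \<tau> n * u (front n - 1)
      - \<tau> * (h_zero f (u (front n - 1)) (u (front n + 1)) (slope n)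
           - h_minus f (u (front n - 2)) (u (front n - 1)))"
    and "size_R \<xi> \<delta> \<tau> (n + 1) * w (front n + 2)
      = size_R \<xi> \<delta> \<tau> n * u (front n + 1) + \<delta> * u (front n + 2)
      - \<tau> * (h_plus f (u (front n + 2)) (u (front n + 3))
           - h_zero f (u (front n - 1)) (u (front n + 1)) (slope n))"
  using assms unfolding scheme_step_def Let_def delta_eq[symmetric]
  by (auto simp: add.commute[of \<delta>] add.assoc)

lemma scheme_step_left:
  assumes "scheme_step f \<xi> N \<tau> n u w" "front (n + 1) = front n - 1"
  shows "\<And>j. - (2 ^ N) \<le> j \<Longrightarrow> j \<le> front n - 3 \<Longrightarrow> std_update (h_minus f) \<delta> \<tau> u w j"
    and "\<And>j. front n + 2 \<le> j \<Longrightarrow> j \<le> 2 ^ N \<Longrightarrow> std_update (h_plus f) \<delta> \<tau> u w j"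
    and "w (front n + 1) = w (front n)"
    and "(size_R \<xi> \<delta> \<tau> (n + 1) + \<delta>) * w (front n) = size_R \<xi> \<delta> \<tau> n * u (front n + 1)
      - \<tau> * (h_plus f (u (front n + 1)) (u (front n + 2))
           - h_zero f (u (front n - 1)) (u (front n + 1)) (slope n))"
    and "size_L \<xi> \<delta> \<tau> (n + 1) * w (front n - 2)
      = size_L \<xi> \<delta> \<tau> n * u (front n - 1) + \<delta> * u (front n - 2)
      - \<tau> * (h_zero f (u (front n - 1)) (u (front n + 1)) (slope n)
           - h_minus f (u (front n - 3)) (u (front n - 2)))"
  using assms unfolding scheme_step_def Let_def delta_eq[symmetric]
  by (auto simp: add.commute[of \<delta>] add.commute[of 1 "front n"])

text \<open>The outer end of the cell jumps by whole cells with the front index, while the inner end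
  moves with the interface. One identity thus yields the length balance of all three cases.\<close>

lemma size_L_step: "size_L \<xi> \<delta> \<tau> (n + 1) + of_int (front (n + 1) - front n) * \<delta>
    = size_L \<xi> \<delta> \<tau> n + \<tau> * slope n"
  unfolding size_L_eq tau_slope by (simp add: algebra_simps)

lemma size_R_step: "size_R \<xi> \<delta> \<tau> (n + 1) - of_int (front (n + 1) - front n) * \<delta>
    = size_R \<xi> \<delta> \<tau> n - \<tau> * slope n"
  unfolding size_R_eq tau_slope by (simp add: algebra_simps)

lemma size_pos: "0 < size_L \<xi> \<delta> \<tau> n" "0 < size_R \<xi> \<delta> \<tau> n"
  using size_ge[of n] delta_pos by auto

lemma admissible_step:
  assumes adm: "admissible n u" and step: "scheme_step f \<xi> N \<tau> n u w"
    and bd: "w (1 + 2 ^ N) = 0" "w (- (1 + 2 ^ N)) = 0"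
  shows "admissible (n + 1) w"
  unfolding admissible_def
proof
  fix j assume "j \<in> {- (2 ^ N) - 1..2 ^ N + 1} - {front (n + 1)}"
  then have j: "- (2 ^ N) - 1 \<le> j" "j \<le> 2 ^ N + 1" "j \<noteq> front (n + 1)" by auto
  note u = admissibleD[OF adm]
  note m = front_range[of n] front_range[of "n + 1"]
  show "w j \<in> {0..1}"
  proof (cases "j = 1 + 2 ^ N \<or> j = - (1 + 2 ^ N)")
    case True
    then show ?thesis using bd by auto
  next
    case False
    then have j': "- (2 ^ N) \<le> j" "j \<le> 2 ^ N" using j by auto
    consider "front (n + 1) = front n" | "front (n + 1) = front n + 1" | "front (n + 1) = front n - 1"
      using front_step[of n] by auto
    then show ?thesis
    proof cases
      case 1
      note s = scheme_step_stay[OF step 1]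
      consider "j \<le> front n - 2" | "j = front n - 1" | "j = front n + 1" | "j \<ge> front n + 2"
        using j(3) 1 by linarith
      then show ?thesis
      proof cases
        case 1
        show ?thesis by (rule std_minus_range[OF s(1)]; (rule u)?; use 1 j' m in linarith)
      next
        case 4
        show ?thesis by (rule std_plus_range[OF s(2)]; (rule u)?; use 4 j' m in linarith)
      next
        case 2
        show ?thesis unfolding 2
          by (rule left_range[OF u u u size_ge(1) tau_slope_le _ size_pos(1) s(3)])
            (use m \<open>front (n + 1) = front n\<close> size_L_step[of n] in auto)
      next
        case 3
        show ?thesis unfolding 3
          by (rule right_range[OF u u u size_ge(2) tau_slope_le _ size_pos(2) s(4)])
            (use m \<open>front (n + 1) = front n\<close> size_R_step[of n] in auto)
      qed
    next
      case 2
      note s = scheme_step_right[OF step 2]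
      \<comment> \<open>The indices m - 1 and m carry the same value, so one bound with the combined
        length serves both.\<close>
      have left: "w (front n) \<in> {0..1}"
        by (rule left_range[OF u u u size_ge(1) tau_slope_le _ _ s(4)])
          (use m 2 size_L_step[of n] size_pos(1)[of "n + 1"] delta_pos in auto)
      consider "j \<le> front n - 2" | "j = front n - 1" | "j = front n" | "j = front n + 2" | "j \<ge> front n + 3"
        using j(3) 2 by linarith
      then show ?thesis
      proof cases
        case 1
        show ?thesis by (rule std_minus_range[OF s(1)]; (rule u)?; use 1 j' m in linarith)
      next
        case 5
        show ?thesis by (rule std_plus_range[OF s(2)]; (rule u)?; use 5 j' m in linarith)
      next
        case 4
        show ?thesis unfolding 4
          by (rule right_merged_range[OF u u u u size_ge(2) tau_slope_le _ size_pos(2) s(5)])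
            (use m 2 size_R_step[of n] in auto)
      qed (use left s(3) in auto)
    next
      case 3
      note s = scheme_step_left[OF step 3]
      have right: "w (front n) \<in> {0..1}"
        by (rule right_range[OF u u u size_ge(2) tau_slope_le _ _ s(4)])
          (use m 3 size_R_step[of n] size_pos(2)[of "n + 1"] delta_pos in auto)
      consider "j \<le> front n - 3" | "j = front n - 2" | "j = front n" | "j = front n + 1" | "j \<ge> front n + 2"
        using j(3) 3 by linarith
      then show ?thesis
      proof cases
        case 1
        show ?thesis by (rule std_minus_range[OF s(1)]; (rule u)?; use 1 j' m in linarith)
      next
        case 5
        show ?thesis by (rule std_plus_range[OF s(2)]; (rule u)?; use 5 j' m in linarith)
      next
        case 2
        show ?thesis unfolding 2
          by (rule left_merged_range[OF u u u u size_ge(1) tau_slope_le _ size_pos(1) s(5)])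
            (use m 3 size_L_step[of n] in auto)
      qed (use right s(3) in auto)
    qed
  qed
qed

section \<open>Entropy inequalities for one step in the three cases of interface motion\<close>

lemma entropy_stay:
  assumes adm: "admissible n u" and step: "scheme_step f \<xi> N \<tau> n u w"
    and k: "k \<in> {0..1}" and stay: "front (n + 1) = front n"
  shows "\<And>j. - (2 ^ N) \<le> j \<Longrightarrow> j \<le> front n - 2 \<Longrightarrow> entropy_ineq (h_minus f) \<delta> \<tau> k u w j"
    and "\<And>j. front n + 2 \<le> j \<Longrightarrow> j \<le> 2 ^ N \<Longrightarrow> entropy_ineq (h_plus f) \<delta> \<tau> k u w j"
    and "size_L \<xi> \<delta> \<tau> (n + 1) * \<bar>w (front n - 1) - k\<bar> \<le> size_L \<xi> \<delta> \<tau> n * \<bar>u (front n - 1) - k\<bar>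
      - \<tau> * (entropy_flux_zero f k (u (front n - 1)) (u (front n + 1)) (slope n)
           - entropy_flux (h_minus f) k u (front n - 1)) + \<tau> * rem_L f k (slope n)"
    and "size_R \<xi> \<delta> \<tau> (n + 1) * \<bar>w (front n + 1) - k\<bar> \<le> size_R \<xi> \<delta> \<tau> n * \<bar>u (front n + 1) - k\<bar>
      - \<tau> * (entropy_flux (h_plus f) k u (front n + 2)
           - entropy_flux_zero f k (u (front n - 1)) (u (front n + 1)) (slope n)) + \<tau> * rem_R f k (slope n)"
proof -
  note u = admissibleD[OF adm]
  note m = front_range[of n]
  note s = scheme_step_stay[OF step stay]
  show "entropy_ineq (h_minus f) \<delta> \<tau> k u w j" if "- (2 ^ N) \<le> j" "j \<le> front n - 2" for j
    by (rule std_minus_entropy[OF s(1) u u u k]; use that m in linarith)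
  show "entropy_ineq (h_plus f) \<delta> \<tau> k u w j" if "front n + 2 \<le> j" "j \<le> 2 ^ N" for j
    by (rule std_plus_entropy[OF s(2) u u u k]; use that m in linarith)
  show "size_L \<xi> \<delta> \<tau> (n + 1) * \<bar>w (front n - 1) - k\<bar> \<le> size_L \<xi> \<delta> \<tau> n * \<bar>u (front n - 1) - k\<bar>
      - \<tau> * (entropy_flux_zero f k (u (front n - 1)) (u (front n + 1)) (slope n)
           - entropy_flux (h_minus f) k u (front n - 1)) + \<tau> * rem_L f k (slope n)"
    \<comment> \<open>\<open>entropy_flux h k u j\<close> belongs to the left edge of cell
      \<open>j\<close>, so index \<open>front n - 1\<close> denotes the edge shared with cell
      \<open>front n - 2\<close>.\<close>
    using left_entropy[OF u u u k size_ge(1) tau_slope_le _ size_pos(1) s(3)]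
      m stay size_L_step[of n] by (simp add: entropy_flux_def add.commute[of 1 "front n"] add.commute[of 2 "front n"])
  show "size_R \<xi> \<delta> \<tau> (n + 1) * \<bar>w (front n + 1) - k\<bar> \<le> size_R \<xi> \<delta> \<tau> n * \<bar>u (front n + 1) - k\<bar>
      - \<tau> * (entropy_flux (h_plus f) k u (front n + 2)
           - entropy_flux_zero f k (u (front n - 1)) (u (front n + 1)) (slope n)) + \<tau> * rem_R f k (slope n)"
    using right_entropy[OF u u u k size_ge(2) tau_slope_le _ size_pos(2) s(4)]
      m stay size_R_step[of n] by (simp add: entropy_flux_def add.commute[of 1 "front n"] add.commute[of 2 "front n"])
qed

lemma entropy_right:
  assumes adm: "admissible n u" and step: "scheme_step f \<xi> N \<tau> n u w"
    and k: "k \<in> {0..1}" and right: "front (n + 1) = front n + 1"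
  shows "\<And>j. - (2 ^ N) \<le> j \<Longrightarrow> j \<le> front n - 2 \<Longrightarrow> entropy_ineq (h_minus f) \<delta> \<tau> k u w j"
    and "\<And>j. front n + 3 \<le> j \<Longrightarrow> j \<le> 2 ^ N \<Longrightarrow> entropy_ineq (h_plus f) \<delta> \<tau> k u w j"
    and "(size_L \<xi> \<delta> \<tau> (n + 1) + \<delta>) * \<bar>w (front n) - k\<bar> \<le> size_L \<xi> \<delta> \<tau> n * \<bar>u (front n - 1) - k\<bar>
      - \<tau> * (entropy_flux_zero f k (u (front n - 1)) (u (front n + 1)) (slope n)
           - entropy_flux (h_minus f) k u (front n - 1)) + \<tau> * rem_L f k (slope n)"
    and "size_R \<xi> \<delta> \<tau> (n + 1) * \<bar>w (front n + 2) - k\<bar>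
      \<le> size_R \<xi> \<delta> \<tau> n * \<bar>u (front n + 1) - k\<bar> + \<delta> * \<bar>u (front n + 2) - k\<bar>
      - \<tau> * (entropy_flux (h_plus f) k u (front n + 3)
           - entropy_flux_zero f k (u (front n - 1)) (u (front n + 1)) (slope n)) + \<tau> * rem_R f k (slope n)"
proof -
  note u = admissibleD[OF adm]
  \<comment> \<open>The bound on the new front is what keeps m + 3, read by the absorbing cell, at
    or below the ghost index \<open>2 ^ N + 1\<close>.\<close>
  note m = front_range[of n] front_range(2)[of "n + 1"]
  note s = scheme_step_right[OF step right]
  have D: "size_R \<xi> \<delta> \<tau> (n + 1) = size_R \<xi> \<delta> \<tau> n + \<delta> - \<tau> * slope n"
    using size_R_step[of n] right by simp
  show "entropy_ineq (h_minus f) \<delta> \<tau> k u w j" if "- (2 ^ N) \<le> j" "j \<le> front n - 2" for j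
    by (rule std_minus_entropy[OF s(1) u u u k]; use that m in linarith)
  show "entropy_ineq (h_plus f) \<delta> \<tau> k u w j" if "front n + 3 \<le> j" "j \<le> 2 ^ N" for j
    by (rule std_plus_entropy[OF s(2) u u u k]; use that m in linarith)
  have "0 < size_L \<xi> \<delta> \<tau> (n + 1) + \<delta>" using size_pos(1)[of "n + 1"] delta_pos by simp
  from left_entropy[OF u u u k size_ge(1) tau_slope_le _ this s(4)]
  show "(size_L \<xi> \<delta> \<tau> (n + 1) + \<delta>) * \<bar>w (front n) - k\<bar> \<le> size_L \<xi> \<delta> \<tau> n * \<bar>u (front n - 1) - k\<bar>
      - \<tau> * (entropy_flux_zero f k (u (front n - 1)) (u (front n + 1)) (slope n)
           - entropy_flux (h_minus f) k u (front n - 1)) + \<tau> * rem_L f k (slope n)"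
    using m right size_L_step[of n] by (simp add: entropy_flux_def add.commute[of 1 "front n"] add.commute[of 2 "front n"])
  show "size_R \<xi> \<delta> \<tau> (n + 1) * \<bar>w (front n + 2) - k\<bar>
      \<le> size_R \<xi> \<delta> \<tau> n * \<bar>u (front n + 1) - k\<bar> + \<delta> * \<bar>u (front n + 2) - k\<bar>
      - \<tau> * (entropy_flux (h_plus f) k u (front n + 3)
           - entropy_flux_zero f k (u (front n - 1)) (u (front n + 1)) (slope n)) + \<tau> * rem_R f k (slope n)"
    using right_merged_entropy[OF u u u u k size_ge(2) tau_slope_le D size_pos(2) s(5)] m right by (simp add: entropy_flux_def add.commute[of 1 "front n"] add.commute[of 2 "front n"])
qed

lemma entropy_left:
  assumes adm: "admissible n u" and step: "scheme_step f \<xi> N \<tau> n u w"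
    and k: "k \<in> {0..1}" and left: "front (n + 1) = front n - 1"
  shows "\<And>j. - (2 ^ N) \<le> j \<Longrightarrow> j \<le> front n - 3 \<Longrightarrow> entropy_ineq (h_minus f) \<delta> \<tau> k u w j"
    and "\<And>j. front n + 2 \<le> j \<Longrightarrow> j \<le> 2 ^ N \<Longrightarrow> entropy_ineq (h_plus f) \<delta> \<tau> k u w j"
    and "(size_R \<xi> \<delta> \<tau> (n + 1) + \<delta>) * \<bar>w (front n) - k\<bar> \<le> size_R \<xi> \<delta> \<tau> n * \<bar>u (front n + 1) - k\<bar>
      - \<tau> * (entropy_flux (h_plus f) k u (front n + 2)
           - entropy_flux_zero f k (u (front n - 1)) (u (front n + 1)) (slope n)) + \<tau> * rem_R f k (slope n)"
    and "size_L \<xi> \<delta> \<tau> (n + 1) * \<bar>w (front n - 2) - k\<bar>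
      \<le> size_L \<xi> \<delta> \<tau> n * \<bar>u (front n - 1) - k\<bar> + \<delta> * \<bar>u (front n - 2) - k\<bar>
      - \<tau> * (entropy_flux_zero f k (u (front n - 1)) (u (front n + 1)) (slope n)
           - entropy_flux (h_minus f) k u (front n - 2)) + \<tau> * rem_L f k (slope n)"
proof -
  note u = admissibleD[OF adm]
  note m = front_range[of n] front_range(1)[of "n + 1"]
  note s = scheme_step_left[OF step left]
  have D: "size_L \<xi> \<delta> \<tau> (n + 1) = size_L \<xi> \<delta> \<tau> n + \<delta> + \<tau> * slope n"
    using size_L_step[of n] left by simp
  show "entropy_ineq (h_minus f) \<delta> \<tau> k u w j" if "- (2 ^ N) \<le> j" "j \<le> front n - 3" for j
    by (rule std_minus_entropy[OF s(1) u u u k]; use that m in linarith)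
  show "entropy_ineq (h_plus f) \<delta> \<tau> k u w j" if "front n + 2 \<le> j" "j \<le> 2 ^ N" for j
    by (rule std_plus_entropy[OF s(2) u u u k]; use that m in linarith)
  have "0 < size_R \<xi> \<delta> \<tau> (n + 1) + \<delta>" using size_pos(2)[of "n + 1"] delta_pos by simp
  from right_entropy[OF u u u k size_ge(2) tau_slope_le _ this s(4)]
  show "(size_R \<xi> \<delta> \<tau> (n + 1) + \<delta>) * \<bar>w (front n) - k\<bar> \<le> size_R \<xi> \<delta> \<tau> n * \<bar>u (front n + 1) - k\<bar>
      - \<tau> * (entropy_flux (h_plus f) k u (front n + 2)
           - entropy_flux_zero f k (u (front n - 1)) (u (front n + 1)) (slope n)) + \<tau> * rem_R f k (slope n)"
    using m left size_R_step[of n] by (simp add: entropy_flux_def add.commute[of 1 "front n"] add.commute[of 2 "front n"])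
  show "size_L \<xi> \<delta> \<tau> (n + 1) * \<bar>w (front n - 2) - k\<bar>
      \<le> size_L \<xi> \<delta> \<tau> n * \<bar>u (front n - 1) - k\<bar> + \<delta> * \<bar>u (front n - 2) - k\<bar>
      - \<tau> * (entropy_flux_zero f k (u (front n - 1)) (u (front n + 1)) (slope n)
           - entropy_flux (h_minus f) k u (front n - 2)) + \<tau> * rem_L f k (slope n)"
    using left_merged_entropy[OF u u u u k size_ge(1) tau_slope_le D size_pos(1) s(5)] m left by (simp add: entropy_flux_def add.commute[of 1 "front n"] add.commute[of 2 "front n"])
qed

section \<open>Bounds in [0,1] for the whole discrete solution\<close>

lemma admissible_initial:
  assumes "AE x in lebesgue_on {-1<..<1}. \<rho>\<^sub>0 x \<in> {0..1}" "scheme_solution f \<xi> N \<tau> \<rho>\<^sub>0 \<rho>"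
  shows "admissible 0 (\<rho> 0)"
  unfolding admissible_def
proof
  fix j assume "j \<in> {- (2 ^ N) - 1..2 ^ N + 1} - {front 0}"
  then have j: "- (2 ^ N) - 1 \<le> j" "j \<le> 2 ^ N + 1" "j \<noteq> front 0" by auto
  show "\<rho> 0 j \<in> {0..1}"
  proof (cases "j = 1 + 2 ^ N \<or> j = - (1 + 2 ^ N)")
    case True
    then show ?thesis using assms(2) by (auto simp: scheme_solution_def)
  next
    case False
    then have "j \<in> {- (2 ^ N)..2 ^ N} - {front 0}" using j by auto
    then have avg: "\<rho> 0 j = (LINT x:cell \<xi> \<delta> \<tau> 0 j|lebesgue. indicator {-1<..<1} x * \<rho>\<^sub>0 x)
        / measure lebesgue (cell \<xi> \<delta> \<tau> 0 j)"
      using assms(2) unfolding scheme_solution_def delta_eq[symmetric] by blast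
    have "AE x in lebesgue. x \<in> {-1<..<1} \<longrightarrow> \<rho>\<^sub>0 x \<in> {0..1}"
      using assms(1) by (subst (asm) AE_restrict_space_iff) auto
    then have "AE x in lebesgue. indicator {-1<..<1} x * \<rho>\<^sub>0 x \<in> {0..1}"
      by eventually_elim (simp split: split_indicator)
    moreover have "cell \<xi> \<delta> \<tau> 0 j \<in> lmeasurable"
      by (auto simp: cell_def cell_L_def cell_R_def fixed_cell_def intro!: bounded_set_imp_lmeasurable)
    ultimately show ?thesis unfolding avg
      by (intro average_range fmeasurableD) (auto simp: fmeasurable_def)
  qed
qed

lemma admissible_solution:
  assumes "AE x in lebesgue_on {-1<..<1}. \<rho>\<^sub>0 x \<in> {0..1}" "scheme_solution f \<xi> N \<tau> \<rho>\<^sub>0 \<rho>"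
  shows "admissible n (\<rho> n)"
proof (induction n)
  case 0
  show ?case by (rule admissible_initial[OF assms])
next
  case (Suc n)
  have "scheme_step f \<xi> N \<tau> n (\<rho> n) (\<rho> (n + 1))"
    "\<rho> (n + 1) (1 + 2 ^ N) = 0" "\<rho> (n + 1) (- (1 + 2 ^ N)) = 0"
    using assms(2) unfolding scheme_solution_def by blast+
  from admissible_step[OF Suc this] show ?case by simp
qed

end

theorem lemma4p3:
  fixes f \<xi> \<rho>\<^sub>0 :: "real \<Rightarrow> real"
    and N n :: nat
    and \<delta> \<tau> k :: real
    and \<rho> :: "nat \<Rightarrow> int \<Rightarrow> real"
    and m m' :: int
    and \<Delta>L \<Delta>L' \<Delta>R \<Delta>R' \<alpha> Q0 :: real
    and Qm Qp :: "int \<Rightarrow> real"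
  assumes f_nonneg: "\<And>r. r \<in> {0..1} \<Longrightarrow> 0 \<le> f r"
    and f_concave: "concave_on {0..1} f"
    and f_ends: "f 0 = 0" "f 1 = 0"
    and f_max: "0 < (SUP r\<in>{0..1}. f r)"
    and f_lim: "\<exists>l. ((\<lambda>r. f r / r) \<longlongrightarrow> l) (at_right 0)"
    and f_lip: "\<exists>L. L-lipschitz_on {0..1} f"
    and xi_range: "\<And>t. t \<ge> 0 \<Longrightarrow> \<xi> t \<in> {-1<..<1}"
    and xi_inf_sup: "{(INF t\<in>{0..}. \<xi> t)..(SUP t\<in>{0..}. \<xi> t)} \<subseteq> {-1<..<1}"
    and xi_lip: "\<exists>L. L-lipschitz_on {0..} \<xi>"
    and rho0_meas: "\<rho>\<^sub>0 \<in> borel_measurable (lebesgue_on {-1<..<1})"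
    and rho0_range: "AE x in lebesgue_on {-1<..<1}. \<rho>\<^sub>0 x \<in> {0..1}"
    and delta: "\<delta> = 1 / 2 ^ N"
    and N_large: "\<And>N'. N' \<ge> N \<Longrightarrow> (SUP t\<in>{0..}. \<bar>\<xi> t\<bar>) < 1 - (1 / 2 ^ N') / 2"
    and tau_pos: "0 < \<tau>"
    and CFL: "\<tau> * max (lip_const {0..1} f) (lip_const {0..} \<xi>) \<le> \<delta> / 2"
    and scheme: "scheme_solution f \<xi> N \<tau> \<rho>\<^sub>0 \<rho>"
    and k: "k \<in> {0..1}"
    and m: "m = tp_index \<xi> \<delta> \<tau> n" and m': "m' = tp_index \<xi> \<delta> \<tau> (n + 1)"
    and DL: "\<Delta>L = size_L \<xi> \<delta> \<tau> n" and DL': "\<Delta>L' = size_L \<xi> \<delta> \<tau> (n + 1)"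
    and DR: "\<Delta>R = size_R \<xi> \<delta> \<tau> n" and DR': "\<Delta>R' = size_R \<xi> \<delta> \<tau> (n + 1)"
    and alpha: "\<alpha> = tp_slope \<xi> \<tau> n"
    and Qm: "Qm = entropy_flux (h_minus f) k (\<rho> n)"
    and Qp: "Qp = entropy_flux (h_plus f) k (\<rho> n)"
    and Q0: "Q0 = entropy_flux_zero f k (\<rho> n (m - 1)) (\<rho> n (m + 1)) \<alpha>"
  shows
    "(m' = m \<longrightarrow>
       (\<forall>j\<in>{- (2 ^ N)..2 ^ N} - {m'}.
          (j \<le> m' - 2 \<longrightarrow> entropy_ineq (h_minus f) \<delta> \<tau> k (\<rho> n) (\<rho> (n + 1)) j) \<and>
          (j \<ge> m' + 2 \<longrightarrow> entropy_ineq (h_plus f) \<delta> \<tau> k (\<rho> n) (\<rho> (n + 1)) j)) \<and>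
       \<Delta>L' * \<bar>\<rho> (n + 1) (m' - 1) - k\<bar>
         \<le> \<Delta>L * \<bar>\<rho> n (m - 1) - k\<bar> - \<tau> * (Q0 - Qm (m - 1)) + \<tau> * rem_L f k \<alpha> \<and>
       \<Delta>R' * \<bar>\<rho> (n + 1) (m' + 1) - k\<bar>
         \<le> \<Delta>R * \<bar>\<rho> n (m + 1) - k\<bar> - \<tau> * (Qp (m + 2) - Q0) + \<tau> * rem_R f k \<alpha>) \<and>
     (m' = m + 1 \<longrightarrow>
       (\<forall>j\<in>{- (2 ^ N)..2 ^ N} - {m'}.
          (j \<le> m' - 3 \<longrightarrow> entropy_ineq (h_minus f) \<delta> \<tau> k (\<rho> n) (\<rho> (n + 1)) j) \<and>
          (j \<ge> m' + 2 \<longrightarrow> entropy_ineq (h_plus f) \<delta> \<tau> k (\<rho> n) (\<rho> (n + 1)) j)) \<and>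
       \<rho> (n + 1) (m' - 2) = \<rho> (n + 1) (m' - 1) \<and>
       (\<Delta>L' + \<delta>) * \<bar>\<rho> (n + 1) (m' - 1) - k\<bar>
         \<le> \<Delta>L * \<bar>\<rho> n (m - 1) - k\<bar> - \<tau> * (Q0 - Qm (m - 1)) + \<tau> * rem_L f k \<alpha> \<and>
       \<Delta>R' * \<bar>\<rho> (n + 1) (m' + 1) - k\<bar>
         \<le> \<Delta>R * \<bar>\<rho> n (m + 1) - k\<bar> + \<delta> * \<bar>\<rho> n (m + 2) - k\<bar>
            - \<tau> * (Qp (m + 3) - Q0) + \<tau> * rem_R f k \<alpha>) \<and>
     (m' = m - 1 \<longrightarrow>
       (\<forall>j\<in>{- (2 ^ N)..2 ^ N} - {m'}.
          (j \<le> m' - 2 \<longrightarrow> entropy_ineq (h_minus f) \<delta> \<tau> k (\<rho> n) (\<rho> (n + 1)) j) \<and>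
          (j \<ge> m' + 3 \<longrightarrow> entropy_ineq (h_plus f) \<delta> \<tau> k (\<rho> n) (\<rho> (n + 1)) j)) \<and>
       \<rho> (n + 1) (m' + 2) = \<rho> (n + 1) (m' + 1) \<and>
       (\<Delta>R' + \<delta>) * \<bar>\<rho> (n + 1) (m' + 1) - k\<bar>
         \<le> \<Delta>R * \<bar>\<rho> n (m + 1) - k\<bar> - \<tau> * (Qp (m + 2) - Q0) + \<tau> * rem_R f k \<alpha> \<and>
       \<Delta>L' * \<bar>\<rho> (n + 1) (m' - 1) - k\<bar>
         \<le> \<Delta>L * \<bar>\<rho> n (m - 1) - k\<bar> + \<delta> * \<bar>\<rho> n (m - 2) - k\<bar>
            - \<tau> * (Q0 - Qm (m - 2)) + \<tau> * rem_L f k \<alpha>)"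
proof -
  define L where "L = lip_const {0..1} f"
  have L: "L-lipschitz_on {0..1} f" unfolding L_def by (rule lip_const_lipschitz[OF f_lip])
  have delta_pos: "0 < \<delta>" using delta by simp
  have CFL_f: "\<tau> * L \<le> \<delta> / 2"
  proof -
    have "\<tau> * L \<le> \<tau> * max (lip_const {0..1} f) (lip_const {0..} \<xi>)"
      using tau_pos unfolding L_def by (intro mult_left_mono) auto
    then show ?thesis using CFL by linarith
  qed
  have inside: "\<bar>\<xi> (real i * \<tau>)\<bar> < 1 - \<delta> / 2" for i
  proof -
    \<comment> \<open>Boundedness makes the supremum in \<open>N_large\<close> a genuine upper
      bound; that assumption is then applied at N' = N.\<close>
    have "\<bar>\<xi> t\<bar> \<le> 1" if "t \<in> {0..}" for t using xi_range[of t] that by auto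
    then have "bdd_above ((\<lambda>t. \<bar>\<xi> t\<bar>) ` {0..})" by (auto intro!: bdd_aboveI2)
    then have "\<bar>\<xi> (real i * \<tau>)\<bar> \<le> (SUP t\<in>{0..}. \<bar>\<xi> t\<bar>)"
      using tau_pos by (intro cSUP_upper) auto
    then show ?thesis using N_large[of N] delta by simp
  qed
  have slow: "\<bar>\<xi> (real (i + 1) * \<tau>) - \<xi> (real i * \<tau>)\<bar> \<le> \<delta> / 2" for i
  proof -
    have "\<bar>\<xi> (real (i + 1) * \<tau>) - \<xi> (real i * \<tau>)\<bar>
        \<le> lip_const {0..} \<xi> * \<bar>real (i + 1) * \<tau> - real i * \<tau>\<bar>"
      using lipschitz_onD[OF lip_const_lipschitz[OF xi_lip], of "real (i + 1) * \<tau>" "real i * \<tau>"] tau_pos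
      by (simp only: dist_real_def) simp
    also have "\<dots> = \<tau> * lip_const {0..} \<xi>" using tau_pos by (simp add: algebra_simps)
    also have "\<dots> \<le> \<tau> * max (lip_const {0..1} f) (lip_const {0..} \<xi>)"
      using tau_pos by (intro mult_left_mono) auto
    also have "\<dots> \<le> \<delta> / 2" by (rule CFL)
    finally show ?thesis .
  qed
  interpret moving_mesh f L \<delta> \<tau> \<xi> N
    using f_nonneg f_concave f_ends(1) f_lim L delta_pos tau_pos CFL_f delta inside slow
    by unfold_locales auto
  have adm: "admissible n (\<rho> n)" by (rule admissible_solution[OF rho0_range scheme])
  have step: "scheme_step f \<xi> N \<tau> n (\<rho> n) (\<rho> (n + 1))"
    using scheme by (simp add: scheme_solution_def)
  note defs = DL DL' DR DR' alpha Q0 Qm Qp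
  have stay: "m' = m \<Longrightarrow> front (n + 1) = front n"
    and right: "m' = m + 1 \<Longrightarrow> front (n + 1) = front n + 1"
    and left: "m' = m - 1 \<Longrightarrow> front (n + 1) = front n - 1"
    using m m' by auto
  show ?thesis
    apply (intro conjI[where P = "m' = m \<longrightarrow> _"] conjI[where P = "m' = m + 1 \<longrightarrow> _"] impI)
    subgoal premises c
      using entropy_stay[OF adm step k stay[OF c]] c by (simp add: defs m[symmetric] add.commute[of 1 m] add.commute[of 2 m])
    subgoal premises c
      using entropy_right[OF adm step k right[OF c]] scheme_step_right(3)[OF step right[OF c]] c
      by (simp add: defs m[symmetric] add.commute[of 1 m] add.commute[of 2 m])
    subgoal premises c
      using entropy_left[OF adm step k left[OF c]] scheme_step_left(3)[OF step left[OF c]] c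
      by (simp add: defs m[symmetric] add.commute[of 1 m] add.commute[of 2 m])
    done
qed

end
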